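(* Let $r\ge 2$ be an integer. Fix an integer $q\ge 2$ and $(\rho_1,\dots,\rho_q)\in(0,1)^q$ with $\sum_{i=1}^q\rho_i=1$. (i) Let $\nu\ge 0$ be a real number. Then there exists a constant $C>0$ such that for each $\varepsilon>0$ and each sufficiently large integer $k$ the following holds. For any $q$-colouring of the edges of the complete $r$-uniform hypergraph on at least $k^{\nu^2C^2(1+\varepsilon)+2r/(r+1)}$ vertices, there exist a colour $j$ and a subset $S$ of the vertices, of size $\ell\ge k$, such that the subhypergraph induced by $S$ in colour $j$ has minimum degree at least $$\rho_j\binom{\ell-1}{r-1}+\nu\sqrt{\ell^{\,r-1}\ln\ell}.$$ (ii) There is a constant $C>0$ such that, if $\nu(\cdot)$ is a non-decreasing non-negative real-valued function (on the positive integers), then for each sufficiently large integer $k$ there is a $q$-colouring of the edges of the complete $r$-uniform hypergraph on $\lfloor Ck^{\nu(k)^2+1}\rfloor$ vertices such that the following holds. For any colour $j$ and any subset $S$ of the vertices of size $\ell\ge k$, the subhypergraph induced by $S$ in colour $j$ has average degree less than $$\rho_j\binom{\ell-1}{r-1}+\nu(\ell)\sqrt{r\binom{\ell-1}{r-1}\ln\ell}.$$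
   Context: The complete $r$-uniform hypergraph on a vertex set $V$ has all $r$-element subsets of $V$ as (hyper)edges. A $q$-colouring of its edges is an arbitrary map from the edges to $\{1,\dots,q\}$. The subhypergraph induced by $S$ in colour $j$ has vertex set $S$ and, as edges, all edges of colour $j$ contained in $S$. The degree of a vertex in a hypergraph is the number of edges containing it; minimum and average degree are taken over all vertices of the hypergraph. $\ln$ is the natural logarithm. *)

theory Defs
  imports Complex_Main "HOL-Library.Ramsey"
begin

text \<open>A hypergraph is a pair consisting of a vertex set and an edge set.
  The \<open>r\<close>-element subsets of \<open>V\<close> are written \<^term>\<open>nsets V r\<close>.\<close>

type_synonym 'v hypergraph = "'v set \<times> 'v set set"

definition complete_hypergraph :: "nat \<Rightarrow> 'v set \<Rightarrow> 'v hypergraph"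
  where "complete_hypergraph r V = (V, nsets V r)"

definition is_colouring :: "nat \<Rightarrow> 'v hypergraph \<Rightarrow> ('v set \<Rightarrow> nat) \<Rightarrow> bool"
  where "is_colouring q H c \<longleftrightarrow> c \<in> snd H \<rightarrow> {1..q}"

definition colour_induced ::
    "'v hypergraph \<Rightarrow> ('v set \<Rightarrow> nat) \<Rightarrow> nat \<Rightarrow> 'v set \<Rightarrow> 'v hypergraph"
  where "colour_induced H c j S = (S, {e \<in> snd H. e \<subseteq> S \<and> c e = j})"

definition degree :: "'v hypergraph \<Rightarrow> 'v \<Rightarrow> nat"
  where "degree H v = card {e \<in> snd H. v \<in> e}"

text \<open>The next two notions are meaningful for a finite nonempty vertex set only.\<close>

definition min_degree :: "'v hypergraph \<Rightarrow> nat"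
  where "min_degree H = Min (degree H ` fst H)"

definition avg_degree :: "'v hypergraph \<Rightarrow> real"
  where "avg_degree H = (\<Sum>v\<in>fst H. real (degree H v)) / real (card (fst H))"

end

theory Submission
  imports Defs "HOL-Probability.Hoeffding" "HOL-Probability.Product_PMF" "HOL-Real_Asymp.Real_Asymp"
begin

text \<open>Call the number of edges of colour \<open>j\<close> inside \<open>S\<close> minus the share \<open>\<rho>\<^sub>j\<close> of all edges inside \<open>S\<close>
  the discrepancy of \<open>S\<close> in colour \<open>j\<close>.

  For the first part, let \<open>S\<close> and \<open>j\<close> maximise the discrepancy minus a penalty \<open>f(|S|)\<close>, where
  \<open>f(l) - f(l - 1)\<close> is the required surplus of degree. No vertex can be deleted from \<open>S\<close> with profit,
  which is the condition on the minimum degree, and \<open>S\<close> has at least \<open>k\<close> vertices if the maximum is at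
  least \<open>k\<^sup>r\<close>. So it suffices to find one set of large discrepancy in one of the colours
  (\<open>exists_large_min_degree\<close>). As the discrepancies of a set in the different colours sum to \<open>0\<close>, a
  set of large absolute discrepancy in the first colour will do.

  Such a set exists for every colouring (\<open>large_discrepancy\<close>), in the manner of Erdos and Spencer.
  Attach random signs to the vertices of \<open>r - 1\<close> disjoint sets of size \<open>l\<close> and consider the signed sum of
  the weights of the edges through a further vertex that meet each of these sets once. Khintchine's
  inequality shows that it typically has order \<open>l\<^bsup>(r-1)/2\<^esup>\<close>. Choosing the best \<open>l\<close> among \<open>n\<close> further
  vertices improves this by a factor of order \<open>\<surd>s\<close>, where \<open>32\<^sup>s\<close> is about \<open>n / l\<close>: a sum of signs
  exceeds its standard deviation by the factor \<open>\<surd>s\<close> as soon as each of \<open>s\<close> equal blocks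
  contributes its own standard deviation, and these \<open>s\<close> events are independent
  (\<open>rad_large_blocks\<close>). The result is a signed sum over transversal edges of order
  \<open>\<surd>s l\<^bsup>(r+1)/2\<^esup>\<close>; it is an alternating sum of \<open>2\<^sup>r\<close> discrepancies (\<open>decoupling\<close>).

  For \<open>\<nu> > 0\<close> take \<open>s\<close> a large multiple of \<open>ln k\<close>, which costs a polynomial number of vertices whose
  exponent determines \<open>C\<close>. For \<open>\<nu> = 0\<close> take \<open>s = 1\<close> and \<open>l\<close> proportional to the number of vertices. The
  exponent \<open>2r/(r+1)\<close> then gives discrepancy \<open>\<gamma> k\<^sup>r\<close> with a constant \<open>\<gamma>\<close> that may be too small. But
  either the maximiser has at least \<open>k\<close> vertices, or it can be removed and the argument repeated on the
  remaining vertices. This yields as many disjoint sets of discrepancy \<open>\<gamma> k\<^sup>r\<close> as desired, and a random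
  union of them shows that the maximum over all sets exceeds \<open>k\<^sup>r\<close> after all (\<open>sum_disc_le\<close>).

  For the second part, colour the edges independently with probabilities \<open>\<rho>\<^sub>j\<close> and combine Hoeffding's
  inequality with the union bound over all subsets (\<open>exists_colouring_small_avg_degree\<close>).\<close>

section \<open>Averages over random signs\<close>

text \<open>A choice of signs on a finite set \<open>P\<close> is encoded by the subset of \<open>P\<close> that receives \<open>+1\<close>,
  so that a uniformly random choice of signs is a uniformly random element of \<^term>\<open>Pow P\<close>.\<close>

definition sgn_in :: "'a set \<Rightarrow> 'a \<Rightarrow> real" where
  "sgn_in S u = (if u \<in> S then 1 else - 1)"

definition avg :: "'a set \<Rightarrow> ('a set \<Rightarrow> real) \<Rightarrow> real" where
  "avg P f = (\<Sum>S\<in>Pow P. f S) / 2 ^ card P"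

lemma avg_cong: "(\<And>S. S \<subseteq> P \<Longrightarrow> f S = g S) \<Longrightarrow> avg P f = avg P g"
  unfolding avg_def by (metis (mono_tags, lifting) PowD sum.cong)

lemma avg_mono: "(\<And>S. S \<subseteq> P \<Longrightarrow> f S \<le> g S) \<Longrightarrow> avg P f \<le> avg P g"
  unfolding avg_def by (auto intro!: divide_right_mono sum_mono)

lemma avg_add: "avg P (\<lambda>S. f S + g S) = avg P f + avg P g"
  unfolding avg_def by (simp add: sum.distrib add_divide_distrib)

lemma avg_diff: "avg P (\<lambda>S. f S - g S) = avg P f - avg P g"
  unfolding avg_def by (simp add: sum_subtractf diff_divide_distrib)

lemma avg_cmult: "avg P (\<lambda>S. c * f S) = c * avg P f"
  unfolding avg_def by (simp add: sum_distrib_left)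

lemma avg_divide: "avg P (\<lambda>S. f S / c) = avg P f / c"
  unfolding avg_def by (simp add: sum_divide_distrib[symmetric] field_simps)

lemma avg_sum: "avg P (\<lambda>S. \<Sum>i\<in>I. f i S) = (\<Sum>i\<in>I. avg P (f i))"
  unfolding avg_def by (simp add: sum.swap[of _ I] sum_divide_distrib)

lemma avg_const: "finite P \<Longrightarrow> avg P (\<lambda>_. c) = c"
  unfolding avg_def by (simp add: card_Pow)

lemma avg_Un:
  assumes "finite P" "finite Q" "P \<inter> Q = {}"
  shows "avg (P \<union> Q) f = avg P (\<lambda>S. avg Q (\<lambda>T. f (S \<union> T)))"
proof -
  have "(\<Sum>S\<in>Pow P. \<Sum>T\<in>Pow Q. f (S \<union> T)) = (\<Sum>(S, T)\<in>Pow P \<times> Pow Q. f (S \<union> T))"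
    by (simp add: sum.cartesian_product)
  also have "\<dots> = (\<Sum>U\<in>Pow (P \<union> Q). f U)"
    by (rule sum.reindex_bij_witness[where i = "\<lambda>U. (U \<inter> P, U \<inter> Q)" and j = "\<lambda>(S, T). S \<union> T"])
       (use assms in auto)
  finally show ?thesis
    unfolding avg_def using assms
    by (simp add: card_Un_disjoint power_add sum_divide_distrib[symmetric] field_simps)
qed

lemma avg_insert:
  assumes "finite P" "v \<notin> P"
  shows "avg (insert v P) f = avg P (\<lambda>S. (f S + f (insert v S)) / 2)"
proof -
  have "avg (P \<union> {v}) f = avg P (\<lambda>S. avg {v} (\<lambda>T. f (S \<union> T)))"
    by (rule avg_Un) (use assms in auto)
  moreover have "avg {v} (\<lambda>T. f (S \<union> T)) = (f S + f (insert v S)) / 2" for S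
    by (simp add: avg_def Pow_insert)
  ultimately show ?thesis by simp
qed

definition rad :: "('a \<Rightarrow> real) \<Rightarrow> 'a set \<Rightarrow> 'a set \<Rightarrow> real" where
  "rad a P S = (\<Sum>u\<in>P. sgn_in S u * a u)"

lemma rad_cong: "S \<inter> P = T \<inter> P \<Longrightarrow> rad a P S = rad a P T"
  unfolding rad_def sgn_in_def by (rule sum.cong) auto

lemma rad_insert:
  assumes "finite P" "v \<notin> P" "S \<subseteq> P"
  shows "rad a (insert v P) S = rad a P S - a v"
    and "rad a (insert v P) (insert v S) = rad a P S + a v"
proof -
  have "rad a P (insert v S) = rad a P S"
    using assms by (intro rad_cong) auto
  then show "rad a (insert v P) S = rad a P S - a v"
    and "rad a (insert v P) (insert v S) = rad a P S + a v"
    using assms by (auto simp: rad_def sgn_in_def)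
qed

lemma avg_rad_square:
  assumes "finite P"
  shows "avg P (\<lambda>S. (rad a P S)\<^sup>2) = (\<Sum>u\<in>P. (a u)\<^sup>2)"
  using assms
proof (induction P rule: finite_induct)
  case empty
  then show ?case by (simp add: avg_def rad_def)
next
  case (insert v P)
  have "avg (insert v P) (\<lambda>S. (rad a (insert v P) S)\<^sup>2) = avg P (\<lambda>S. (rad a P S)\<^sup>2 + (a v)\<^sup>2)"
    unfolding avg_insert[OF insert.hyps(1,2)]
    by (rule avg_cong)
       (simp add: rad_insert[OF insert.hyps(1,2)] power2_eq_square algebra_simps)
  then show ?case
    using insert by (simp add: avg_add avg_const)
qed

lemma avg_rad_fourth_le:
  assumes "finite P"
  shows "avg P (\<lambda>S. rad a P S ^ 4) \<le> 3 * (\<Sum>u\<in>P. (a u)\<^sup>2)\<^sup>2"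
  using assms
proof (induction P rule: finite_induct)
  case empty
  then show ?case by (simp add: avg_def rad_def)
next
  case (insert v P)
  let ?s = "\<Sum>u\<in>P. (a u)\<^sup>2"
  have "avg (insert v P) (\<lambda>S. rad a (insert v P) S ^ 4)
      = avg P (\<lambda>S. rad a P S ^ 4 + (6 * (a v)\<^sup>2 * (rad a P S)\<^sup>2 + a v ^ 4))"
    unfolding avg_insert[OF insert.hyps(1,2)]
    by (rule avg_cong)
       (simp add: rad_insert[OF insert.hyps(1,2)] power2_eq_square power4_eq_xxxx algebra_simps)
  also have "\<dots> = avg P (\<lambda>S. rad a P S ^ 4) + (6 * (a v)\<^sup>2 * ?s + a v ^ 4)"
    using insert.hyps by (simp add: avg_add avg_cmult avg_const avg_rad_square)
  also have "\<dots> \<le> 3 * ?s\<^sup>2 + (6 * (a v)\<^sup>2 * ?s + 3 * a v ^ 4)"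
  proof -
    have "0 \<le> a v ^ 4" by simp
    then show ?thesis using insert.IH by linarith
  qed
  also have "\<dots> = 3 * (\<Sum>u\<in>insert v P. (a u)\<^sup>2)\<^sup>2"
    using insert.hyps by (simp add: power2_eq_square power4_eq_xxxx algebra_simps)
  finally show ?case .
qed

text \<open>Khintchine's inequality. Since the fourth moment is controlled by the second one, the mass of
  a Rademacher sum cannot hide in rare large values: for \<open>y \<ge> 0\<close> one has
  \<open>y \<ge> y\<^sup>2 - 4/27 y\<^sup>4\<close>, because the difference of the two sides is
  \<open>4/27 y (y - 3/2)\<^sup>2 (y + 3)\<close>; averaging this over the normalised sum gives
  at least \<open>1 - 12/27 \<ge> 1/2\<close>.\<close>

lemma khintchine:
  assumes "finite P"
  shows "sqrt (\<Sum>u\<in>P. (a u)\<^sup>2) / 2 \<le> avg P (\<lambda>S. \<bar>rad a P S\<bar>)"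
proof -
  define \<sigma> where "\<sigma> = sqrt (\<Sum>u\<in>P. (a u)\<^sup>2)"
  have sq: "\<sigma>\<^sup>2 = (\<Sum>u\<in>P. (a u)\<^sup>2)"
    unfolding \<sigma>_def by (simp add: sum_nonneg)
  have nonneg: "0 \<le> avg P (\<lambda>S. \<bar>rad a P S\<bar>)"
    unfolding avg_def by (simp add: sum_nonneg)
  show ?thesis
  proof (cases "\<sigma> = 0")
    case True
    then show ?thesis using nonneg by (simp add: \<sigma>_def)
  next
    case False
    moreover have "\<sigma> \<ge> 0" by (simp add: \<sigma>_def sum_nonneg)
    ultimately have pos: "\<sigma> > 0" by simp
    have key: "y\<^sup>2 - 4/27 * y ^ 4 \<le> y" if "y \<ge> 0" for y :: real
    proof -
      have "0 \<le> 4/27 * (y * ((y - 3/2)\<^sup>2 * (y + 3)))" using that by simp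
      also have "\<dots> = y - (y\<^sup>2 - 4/27 * y ^ 4)"
        by (simp add: power2_eq_square power4_eq_xxxx algebra_simps)
      finally show ?thesis by simp
    qed
    have "\<sigma> * (1 - 4/27 * 3) = (\<sigma>\<^sup>2 - 4/27 / \<sigma>\<^sup>2 * (3 * (\<sigma>\<^sup>2)\<^sup>2)) / \<sigma>"
      using pos by (simp add: field_simps power2_eq_square)
    also have "\<dots> \<le> (\<sigma>\<^sup>2 - 4/27 / \<sigma>\<^sup>2 * avg P (\<lambda>S. rad a P S ^ 4)) / \<sigma>"
      using avg_rad_fourth_le[OF assms, of a] pos
      by (intro divide_right_mono diff_left_mono mult_left_mono) (simp_all add: sq sum_nonneg)
    also have "\<dots> = avg P (\<lambda>S. ((rad a P S)\<^sup>2 - 4/27 / \<sigma>\<^sup>2 * rad a P S ^ 4) / \<sigma>)"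
      by (simp only: avg_divide avg_diff avg_cmult avg_rad_square[OF assms] sq)
    also have "\<dots> \<le> avg P (\<lambda>S. \<bar>rad a P S\<bar>)"
    proof (rule avg_mono)
      fix S
      let ?y = "\<bar>rad a P S\<bar> / \<sigma>"
      have "((rad a P S)\<^sup>2 - 4/27 / \<sigma>\<^sup>2 * rad a P S ^ 4) / \<sigma> = \<sigma> * (?y\<^sup>2 - 4/27 * ?y ^ 4)"
        using pos by (simp add: power_divide field_simps power2_eq_square power4_eq_xxxx abs_mult_self_eq)
      also have "\<dots> \<le> \<sigma> * ?y"
        using pos key[of ?y] by (intro mult_left_mono) auto
      finally show "((rad a P S)\<^sup>2 - 4/27 / \<sigma>\<^sup>2 * rad a P S ^ 4) / \<sigma> \<le> \<bar>rad a P S\<bar>"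
        using pos by simp
    qed
    finally have "\<sigma> * (1 - 4/27 * 3) \<le> avg P (\<lambda>S. \<bar>rad a P S\<bar>)" .
    moreover have "\<sigma> / 2 \<le> \<sigma> * (1 - 4/27 * 3)" using pos by simp
    ultimately show ?thesis unfolding \<sigma>_def by linarith
  qed
qed

lemma cauchy_schwarz_sum:
  fixes f g :: "'a \<Rightarrow> real"
  shows "(\<Sum>i\<in>A. f i * g i) \<le> sqrt (\<Sum>i\<in>A. (f i)\<^sup>2) * sqrt (\<Sum>i\<in>A. (g i)\<^sup>2)"
proof -
  have "(\<Sum>i\<in>A. f i * g i) \<le> (\<Sum>i\<in>A. \<bar>f i\<bar> * \<bar>g i\<bar>)"
    by (intro sum_mono) (metis abs_ge_self abs_mult)
  then show ?thesis
    using L2_set_mult_ineq[where f = f and g = g and A = A] unfolding L2_set_def by linarith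
qed

text \<open>The inequality of Paley and Zygmund. The values below half the mean contribute at most half of the
  mean; by Cauchy's inequality the others can make up the rest only if they are frequent enough for the
  given second moment \<open>B\<close>.\<close>


lemma paley_zygmund:
  fixes f :: "'a \<Rightarrow> real"
  assumes "finite \<Omega>" and f: "\<And>\<omega>. \<omega> \<in> \<Omega> \<Longrightarrow> 0 \<le> f \<omega>" and "0 \<le> \<mu>"
    and mean: "\<mu> * real (card \<Omega>) \<le> (\<Sum>\<omega>\<in>\<Omega>. f \<omega>)"
    and square: "(\<Sum>\<omega>\<in>\<Omega>. (f \<omega>)\<^sup>2) \<le> B * real (card \<Omega>)"
  shows "(\<mu> / 2)\<^sup>2 * real (card \<Omega>) \<le> B * real (card {\<omega>\<in>\<Omega>. \<mu> / 2 \<le> f \<omega>})"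
proof (cases "\<Omega> = {}")
  case True
  then show ?thesis by simp
next
  case False
  define n where "n = real (card \<Omega>)"
  have n: "n > 0" using False assms(1) by (simp add: n_def card_gt_0_iff)
  define G where "G = {\<omega>\<in>\<Omega>. \<mu> / 2 \<le> f \<omega>}"
  have G: "G \<subseteq> \<Omega>" "finite G" using assms(1) by (auto simp: G_def)
  have "(\<Sum>\<omega>\<in>\<Omega>. f \<omega>) = (\<Sum>\<omega>\<in>\<Omega> - G. f \<omega>) + (\<Sum>\<omega>\<in>G. f \<omega>)"
    using G assms(1) by (metis sum.subset_diff)
  moreover have "(\<Sum>\<omega>\<in>\<Omega> - G. f \<omega>) \<le> real (card (\<Omega> - G)) * (\<mu> / 2)"
    by (rule sum_bounded_above) (auto simp: G_def)
  moreover have "real (card (\<Omega> - G)) * (\<mu> / 2) \<le> n * (\<mu> / 2)"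
    unfolding n_def using assms by (intro mult_right_mono) (auto intro: card_mono)
  ultimately have "\<mu> / 2 * n \<le> (\<Sum>\<omega>\<in>G. f \<omega>)"
    using mean unfolding n_def[symmetric] by (simp add: algebra_simps)
  also have "\<dots> = (\<Sum>\<omega>\<in>G. f \<omega> * 1)" by simp
  also have "\<dots> \<le> sqrt (\<Sum>\<omega>\<in>G. (f \<omega>)\<^sup>2) * sqrt (\<Sum>\<omega>\<in>G. 1\<^sup>2)"
    by (rule cauchy_schwarz_sum)
  also have "\<dots> = sqrt ((\<Sum>\<omega>\<in>G. (f \<omega>)\<^sup>2) * real (card G))"
    by (simp add: real_sqrt_mult)
  finally have "(\<mu> / 2 * n)\<^sup>2 \<le> (sqrt ((\<Sum>\<omega>\<in>G. (f \<omega>)\<^sup>2) * real (card G)))\<^sup>2"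
    using assms n by (intro power_mono) auto
  also have "\<dots> = (\<Sum>\<omega>\<in>G. (f \<omega>)\<^sup>2) * real (card G)"
    by (simp add: sum_nonneg)
  also have "\<dots> \<le> (\<Sum>\<omega>\<in>\<Omega>. (f \<omega>)\<^sup>2) * real (card G)"
    using G assms(1) by (intro mult_right_mono sum_mono2) auto
  also have "\<dots> \<le> B * n * real (card G)"
    using square by (intro mult_right_mono) (auto simp: n_def)
  finally have "n * ((\<mu> / 2)\<^sup>2 * n) \<le> n * (B * real (card G))"
    by (simp add: power2_eq_square algebra_simps)
  then show ?thesis using n unfolding n_def[symmetric] G_def[symmetric] by simp
qed

text \<open>By Khintchine's inequality and the second moment, the absolute value of the sum exceeds a quarter of
  the standard deviation with probability at least \<open>1/16\<close>. Reversing all signs negates the sum, so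
  positive values account for half of this probability.\<close>

lemma rad_large_half:
  assumes "finite P"
  shows "2 ^ card P \<le> 32 * real (card {S\<in>Pow P. sqrt (\<Sum>u\<in>P. (a u)\<^sup>2) / 4 \<le> rad a P S})"
proof -
  define \<sigma> where "\<sigma> = sqrt (\<Sum>u\<in>P. (a u)\<^sup>2)"
  have sq: "\<sigma>\<^sup>2 = (\<Sum>u\<in>P. (a u)\<^sup>2)"
    unfolding \<sigma>_def by (simp add: sum_nonneg)
  define G where "G = {S\<in>Pow P. \<sigma> / 4 \<le> rad a P S}"
  define H where "H = {S\<in>Pow P. \<sigma> / 2 / 2 \<le> \<bar>rad a P S\<bar>}"
  have finG: "finite G" using assms by (simp add: G_def)
  have flip: "rad a P (P - S) = - rad a P S" for S
    unfolding rad_def sgn_in_def sum_negf[symmetric] by (rule sum.cong) auto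
  have "H \<subseteq> G \<union> (\<lambda>S. P - S) ` G"
  proof
    fix S assume S: "S \<in> H"
    show "S \<in> G \<union> (\<lambda>S. P - S) ` G"
    proof (cases "rad a P S \<ge> 0")
      case True
      then show ?thesis using S by (simp add: G_def H_def)
    next
      case False
      then have "P - S \<in> G" using S by (simp add: G_def H_def flip)
      moreover have "S = P - (P - S)" using S by (auto simp: H_def)
      ultimately show ?thesis by blast
    qed
  qed
  then have "card H \<le> card G + card ((\<lambda>S. P - S) ` G)"
    using finG by (meson card_Un_le card_mono finite_UnI finite_imageI order_trans)
  also have "\<dots> \<le> 2 * card G"
    using finG card_image_le[of G "\<lambda>S. P - S"] by simp
  finally have HG: "real (card H) \<le> 2 * real (card G)" by linarith
  have "2 ^ card P \<le> 32 * real (card G)"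
  proof (cases "\<sigma> = 0")
    case True
    then have "H = Pow P" by (auto simp: H_def)
    then show ?thesis using HG assms by (simp add: card_Pow)
  next
    case False
    have "(\<sigma> / 2 / 2)\<^sup>2 * real (card (Pow P)) \<le> \<sigma>\<^sup>2 * real (card H)"
      unfolding H_def
    proof (rule paley_zygmund)
      show "\<sigma> / 2 * real (card (Pow P)) \<le> (\<Sum>S\<in>Pow P. \<bar>rad a P S\<bar>)"
        using khintchine[OF assms, of a] assms
        by (simp add: avg_def \<sigma>_def card_Pow field_simps)
      show "(\<Sum>S\<in>Pow P. \<bar>rad a P S\<bar>\<^sup>2) \<le> \<sigma>\<^sup>2 * real (card (Pow P))"
        using avg_rad_square[OF assms, of a] assms
        by (simp add: avg_def sq card_Pow field_simps)
    qed (use assms in \<open>auto simp: \<sigma>_def sum_nonneg\<close>)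
    then have "\<sigma>\<^sup>2 * 2 ^ card P \<le> \<sigma>\<^sup>2 * (16 * real (card H))"
      using assms by (simp add: card_Pow power_divide field_simps)
    then have "2 ^ card P \<le> 16 * real (card H)"
      using False by simp
    then show ?thesis using HG by linarith
  qed
  then show ?thesis by (simp add: G_def \<sigma>_def)
qed

text \<open>The source of the logarithmic gain. On each of \<open>s\<close> disjoint blocks the sum exceeds a constant
  multiple of its standard deviation with probability at least \<open>1/32\<close>, independently of the other
  blocks. So with probability at least \<open>32\<^sup>-\<^sup>s\<close> all these gains occur together; if the blocks
  are comparable, their total exceeds the standard deviation of the whole sum by a factor
  of order \<open>\<surd>s\<close>.\<close>

lemma rad_large_blocks:
  fixes A :: "'i \<Rightarrow> 'a set"
  assumes "finite I" and "\<And>i. i \<in> I \<Longrightarrow> finite (A i)" and "disjoint_family_on A I"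
  shows "2 ^ card (\<Union>i\<in>I. A i) \<le> 32 ^ card I *
    real (card {S\<in>Pow (\<Union>i\<in>I. A i). (\<Sum>i\<in>I. sqrt (\<Sum>u\<in>A i. (a u)\<^sup>2)) / 4 \<le> rad a (\<Union>i\<in>I. A i) S})"
  using assms
proof (induction I rule: finite_induct)
  case empty
  then show ?case by (simp add: rad_def)
next
  case (insert i I)
  define U where "U = (\<Union>i\<in>I. A i)"
  define LU where "LU = (\<Sum>i\<in>I. sqrt (\<Sum>u\<in>A i. (a u)\<^sup>2)) / 4"
  define LA where "LA = sqrt (\<Sum>u\<in>A i. (a u)\<^sup>2) / 4"
  define G where "G = {S\<in>Pow U. LU \<le> rad a U S}"
  define H where "H = {S\<in>Pow (A i). LA \<le> rad a (A i) S}"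
  define K where "K = {S\<in>Pow (A i \<union> U). LA + LU \<le> rad a (A i \<union> U) S}"
  have fin: "finite U" "finite (A i)" using insert by (auto simp: U_def)
  have disj: "A i \<inter> U = {}"
    using insert.prems(2) insert.hyps(2) by (auto simp: U_def disjoint_family_on_def)
  have IH: "2 ^ card U \<le> 32 ^ card I * real (card G)"
    using insert unfolding U_def G_def LU_def disjoint_family_on_def by simp
  have H: "2 ^ card (A i) \<le> 32 * real (card H)"
    unfolding H_def LA_def by (rule rad_large_half[OF fin(2)])
  have rad: "rad a (A i \<union> U) (S \<union> T) = rad a (A i) S + rad a U T" if "S \<subseteq> A i" "T \<subseteq> U" for S T
  proof -
    have "rad a (A i \<union> U) (S \<union> T) = rad a (A i) (S \<union> T) + rad a U (S \<union> T)"
      unfolding rad_def using fin disj by (rule_tac sum.union_disjoint) auto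
    moreover have "rad a (A i) (S \<union> T) = rad a (A i) S" "rad a U (S \<union> T) = rad a U T"
      using that disj by (auto intro!: rad_cong)
    ultimately show ?thesis by simp
  qed
  have "inj_on (\<lambda>(S, T). S \<union> T) (H \<times> G)"
  proof (rule inj_on_inverseI[where g = "\<lambda>R. (R \<inter> A i, R \<inter> U)"])
    fix x assume "x \<in> H \<times> G"
    then show "(\<lambda>R. (R \<inter> A i, R \<inter> U)) ((\<lambda>(S, T). S \<union> T) x) = x"
      using disj by (auto simp: H_def G_def)
  qed
  then have "card (H \<times> G) = card ((\<lambda>(S, T). S \<union> T) ` (H \<times> G))"
    by (simp add: card_image)
  also have "\<dots> \<le> card K"
  proof (rule card_mono)
    show "finite K" using fin by (simp add: K_def)
    show "(\<lambda>(S, T). S \<union> T) ` (H \<times> G) \<subseteq> K"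
    proof clarify
      fix S T assume "S \<in> H" "T \<in> G"
      then have "S \<subseteq> A i" "T \<subseteq> U" "LA \<le> rad a (A i) S" "LU \<le> rad a U T"
        by (auto simp: H_def G_def)
      then show "S \<union> T \<in> K" using rad[of S T] by (auto simp: K_def)
    qed
  qed
  finally have HG: "real (card H) * real (card G) \<le> real (card K)"
    by (simp add: card_cartesian_product flip: of_nat_mult)
  have "(2::real) ^ card (A i \<union> U) = 2 ^ card (A i) * 2 ^ card U"
    using fin disj by (simp add: card_Un_disjoint power_add)
  also have "\<dots> \<le> (32 * real (card H)) * (32 ^ card I * real (card G))"
    using H IH by (intro mult_mono) auto
  also have "\<dots> = 32 ^ card (insert i I) * (real (card H) * real (card G))"
    using insert.hyps by simp
  also have "\<dots> \<le> 32 ^ card (insert i I) * real (card K)"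
    using HG by (intro mult_left_mono) auto
  finally show ?case
    using insert.hyps unfolding K_def U_def LA_def LU_def by (simp add: add_divide_distrib)
qed

text \<open>Minkowski's inequality. Cauchy's inequality for the inner product of the random vector of absolute
  values with its own mean is averaged over the signs.\<close>


lemma avg_norm_ge:
  assumes "finite P"
  shows "sqrt (\<Sum>u\<in>A. (avg P (\<lambda>S. \<bar>f u S\<bar>))\<^sup>2) \<le> avg P (\<lambda>S. sqrt (\<Sum>u\<in>A. (f u S)\<^sup>2))"
proof -
  define m where "m u = avg P (\<lambda>S. \<bar>f u S\<bar>)" for u
  define M where "M = sqrt (\<Sum>u\<in>A. (m u)\<^sup>2)"
  have "M * M = (\<Sum>u\<in>A. m u * m u)"
    unfolding M_def by (simp add: sum_nonneg power2_eq_square)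
  also have "\<dots> = avg P (\<lambda>S. \<Sum>u\<in>A. m u * \<bar>f u S\<bar>)"
    by (simp add: avg_sum avg_cmult m_def)
  also have "\<dots> \<le> avg P (\<lambda>S. M * sqrt (\<Sum>u\<in>A. (f u S)\<^sup>2))"
    unfolding M_def
    by (rule avg_mono) (use cauchy_schwarz_sum[of m "\<lambda>u. \<bar>f u _\<bar>" A] in simp)
  also have "\<dots> = M * avg P (\<lambda>S. sqrt (\<Sum>u\<in>A. (f u S)\<^sup>2))"
    by (rule avg_cmult)
  finally have *: "M * M \<le> M * avg P (\<lambda>S. sqrt (\<Sum>u\<in>A. (f u S)\<^sup>2))" .
  have "0 \<le> M" "0 \<le> avg P (\<lambda>S. sqrt (\<Sum>u\<in>A. (f u S)\<^sup>2))"
    unfolding M_def avg_def by (auto intro!: sum_nonneg divide_nonneg_nonneg)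
  then have "M \<le> avg P (\<lambda>S. sqrt (\<Sum>u\<in>A. (f u S)\<^sup>2))"
    using * by (cases "M = 0") (auto simp: mult_le_cancel_left)
  then show ?thesis by (simp add: M_def m_def)
qed

section \<open>Multilinear forms in random signs\<close>

definition disc :: "('a set \<Rightarrow> real) \<Rightarrow> nat \<Rightarrow> 'a set \<Rightarrow> real" where
  "disc x r T = (\<Sum>e\<in>nsets T r. x e)"

text \<open>The form multiplies the weight of \<open>e \<union> {v\<^sub>0, \<dots>, v\<^bsub>d-1\<^esub>}\<close> with the signs of
  \<open>v\<^sub>i \<in> P i\<close> and sums over all such choices. It is defined by recursion so that, as a function
  of the signs on the last part, it is visibly a Rademacher sum.\<close>

fun form :: "('a set \<Rightarrow> real) \<Rightarrow> (nat \<Rightarrow> 'a set) \<Rightarrow> nat \<Rightarrow> 'a set \<Rightarrow> 'a set \<Rightarrow> real" where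
  "form x P 0 S e = x e"
| "form x P (Suc d) S e = rad (\<lambda>u. form x P d S (insert u e)) (P d) S"

lemma form_cong:
  "S \<inter> (\<Union>i<d. P i) = T \<inter> (\<Union>i<d. P i) \<Longrightarrow> form x P d S e = form x P d T e"
proof (induction d arbitrary: e)
  case (Suc d)
  have "form x P d S e = form x P d T e" for e
    using Suc.prems by (intro Suc.IH) (auto simp: lessThan_Suc)
  moreover have "S \<inter> P d = T \<inter> P d"
    using Suc.prems by (auto simp: lessThan_Suc)
  ultimately show ?case by (auto intro: rad_cong)
qed simp

lemma form_parts_cong:
  "(\<And>i. i < d \<Longrightarrow> P i = Q i) \<Longrightarrow> form x P d S e = form x Q d S e"
proof (induction d arbitrary: e)
  case (Suc d)
  have "form x P d S e = form x Q d S e" for e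
    by (rule Suc.IH) (simp add: Suc.prems)
  then show ?case by (simp add: Suc.prems)
qed simp

lemma avg_form_Suc:
  assumes "\<And>i. i < Suc d \<Longrightarrow> finite (P i)" "disjoint_family_on P {..<Suc d}"
  shows "avg (\<Union>i<Suc d. P i) (\<lambda>S. g (form x P (Suc d) S e)) =
    avg (\<Union>i<d. P i) (\<lambda>S. avg (P d) (\<lambda>T. g (rad (\<lambda>u. form x P d S (insert u e)) (P d) T)))"
proof -
  have disj: "(\<Union>i<d. P i) \<inter> P d = {}"
  proof -
    have "P i \<inter> P d = {}" if "i < d" for i
      using assms(2) that by (auto simp: disjoint_family_on_def)
    then show ?thesis by blast
  qed
  have U: "(\<Union>i<Suc d. P i) = (\<Union>i<d. P i) \<union> P d"
    by (auto simp: lessThan_Suc)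
  have "avg (\<Union>i<Suc d. P i) (\<lambda>S. g (form x P (Suc d) S e)) =
    avg (\<Union>i<d. P i) (\<lambda>S. avg (P d) (\<lambda>T. g (form x P (Suc d) (S \<union> T) e)))"
    unfolding U using assms disj by (intro avg_Un) auto
  also have "\<dots> =
    avg (\<Union>i<d. P i) (\<lambda>S. avg (P d) (\<lambda>T. g (rad (\<lambda>u. form x P d S (insert u e)) (P d) T)))"
  proof (intro avg_cong)
    fix S T assume ST: "S \<subseteq> (\<Union>i<d. P i)" "T \<subseteq> P d"
    have "form x P d (S \<union> T) e' = form x P d S e'" for e'
      using ST disj by (intro form_cong) auto
    moreover have "rad a (P d) (S \<union> T) = rad a (P d) T" for a
      using ST disj by (intro rad_cong) auto
    ultimately show "g (form x P (Suc d) (S \<union> T) e)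
        = g (rad (\<lambda>u. form x P d S (insert u e)) (P d) T)"
      by simp
  qed
  finally show ?thesis .
qed

text \<open>Khintchine's inequality, applied to one part at a time. Minkowski's inequality carries the
  induction: it replaces the coefficients on the last part, which are random themselves, by their
  mean absolute values.\<close>

lemma avg_abs_form_ge:
  assumes "\<And>i. i < d \<Longrightarrow> finite (P i)" "disjoint_family_on P {..<d}"
    and "\<And>i. i < d \<Longrightarrow> card (P i) = l" and x: "\<And>e. \<delta> \<le> \<bar>x e\<bar>" and "0 \<le> \<delta>"
  shows "\<delta> / 2 ^ d * sqrt (real l ^ d) \<le> avg (\<Union>i<d. P i) (\<lambda>S. \<bar>form x P d S e\<bar>)"
  using assms(1-3)
proof (induction d arbitrary: e)
  case 0
  then show ?case using x by (simp add: avg_def)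
next
  case (Suc d)
  let ?U = "\<Union>i<d. P i"
  let ?f = "\<lambda>u S. form x P d S (insert u e)"
  have finU: "finite ?U" using Suc.prems(1) by auto
  have disj: "disjoint_family_on P {..<d}"
    using Suc.prems(2) by (rule disjoint_family_on_mono[rotated]) auto
  have IH: "\<delta> / 2 ^ d * sqrt (real l ^ d) \<le> avg ?U (\<lambda>S. \<bar>form x P d S e\<bar>)" for e
    using Suc.prems disj by (intro Suc.IH) auto
  define b where "b = \<delta> / 2 ^ d * sqrt (real l ^ d)"
  have b: "0 \<le> b" using assms(5) by (simp add: b_def)
  have "\<delta> / 2 ^ Suc d * sqrt (real l ^ Suc d) = sqrt (real l) * b / 2"
    by (simp add: b_def real_sqrt_mult field_simps)
  also have "\<dots> = sqrt (\<Sum>u\<in>P d. b\<^sup>2) / 2"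
    using Suc.prems(3) b by (simp add: real_sqrt_mult)
  also have "\<dots> \<le> sqrt (\<Sum>u\<in>P d. (avg ?U (\<lambda>S. \<bar>?f u S\<bar>))\<^sup>2) / 2"
    using IH b by (intro divide_right_mono real_sqrt_le_mono sum_mono power_mono) (auto simp: b_def)
  also have "\<dots> \<le> avg ?U (\<lambda>S. sqrt (\<Sum>u\<in>P d. (?f u S)\<^sup>2)) / 2"
    using avg_norm_ge[OF finU, of ?f "P d"] by simp
  also have "\<dots> = avg ?U (\<lambda>S. sqrt (\<Sum>u\<in>P d. (?f u S)\<^sup>2) / 2)"
    by (rule avg_divide[symmetric])
  also have "\<dots> \<le> avg ?U (\<lambda>S. avg (P d) (\<lambda>T. \<bar>rad (\<lambda>u. ?f u S) (P d) T\<bar>))"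
    using Suc.prems(1) by (intro avg_mono khintchine) auto
  also have "\<dots> = avg (\<Union>i<Suc d. P i) (\<lambda>S. \<bar>form x P (Suc d) S e\<bar>)"
    by (rule avg_form_Suc[OF Suc.prems(1,2), where g = abs, symmetric])
  finally show ?case .
qed

lemma avg_form_square_le:
  assumes "\<And>i. i < d \<Longrightarrow> finite (P i)" "disjoint_family_on P {..<d}"
    and "\<And>i. i < d \<Longrightarrow> card (P i) = l" and x: "\<And>e. \<bar>x e\<bar> \<le> 1"
  shows "avg (\<Union>i<d. P i) (\<lambda>S. (form x P d S e)\<^sup>2) \<le> real l ^ d"
  using assms(1-3)
proof (induction d arbitrary: e)
  case 0
  then show ?case using x[of e] abs_square_le_1[of "x e"] by (simp add: avg_def)
next
  case (Suc d)
  let ?U = "\<Union>i<d. P i"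
  have disj: "disjoint_family_on P {..<d}"
    using Suc.prems(2) by (rule disjoint_family_on_mono[rotated]) auto
  have "avg (\<Union>i<Suc d. P i) (\<lambda>S. (form x P (Suc d) S e)\<^sup>2)
      = avg ?U (\<lambda>S. avg (P d) (\<lambda>T. (rad (\<lambda>u. form x P d S (insert u e)) (P d) T)\<^sup>2))"
    by (rule avg_form_Suc[OF Suc.prems(1,2), where g = "\<lambda>y. y\<^sup>2"])
  also have "\<dots> = avg ?U (\<lambda>S. \<Sum>u\<in>P d. (form x P d S (insert u e))\<^sup>2)"
    using Suc.prems(1) by (simp add: avg_rad_square)
  also have "\<dots> = (\<Sum>u\<in>P d. avg ?U (\<lambda>S. (form x P d S (insert u e))\<^sup>2))"
    by (rule avg_sum)
  also have "\<dots> \<le> (\<Sum>u\<in>P d. real l ^ d)"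
    using Suc.prems disj by (intro sum_mono Suc.IH) auto
  also have "\<dots> = real l ^ Suc d" using Suc.prems(3) by simp
  finally show ?case .
qed

section \<open>From forms to discrepancy\<close>

definition transversals :: "(nat \<Rightarrow> 'a set) \<Rightarrow> nat \<Rightarrow> 'a set set" where
  "transversals P d = {e. e \<subseteq> (\<Union>i<d. P i) \<and> (\<forall>i<d. card (e \<inter> P i) = 1)}"

text \<open>On a set that meets \<open>Q\<close> in one vertex this is the sign of that vertex; on a set that misses
  \<open>Q\<close> the two terms cancel.\<close>

definition part_sign :: "'a set \<Rightarrow> 'a set \<Rightarrow> 'a set \<Rightarrow> real" where
  "part_sign S Q e = of_bool (e \<inter> Q \<subseteq> S) - of_bool (e \<inter> Q \<inter> S = {})"

lemma form_eq_sum_transversals: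
  assumes "\<And>i. i < d \<Longrightarrow> finite (P i)" "disjoint_family_on P {..<d}"
  shows "form x P d S e\<^sub>0 = (\<Sum>e\<in>transversals P d. (\<Prod>i<d. part_sign S (P i) e) * x (e \<union> e\<^sub>0))"
  using assms
proof (induction d arbitrary: e\<^sub>0)
  case 0
  have "transversals P 0 = {{}}" by (auto simp: transversals_def)
  then show ?case by simp
next
  case (Suc d)
  let ?w = "\<lambda>d e. \<Prod>i<d. part_sign S (P i) e"
  have disj: "disjoint_family_on P {..<d}"
    using Suc.prems(2) by (rule disjoint_family_on_mono[rotated]) auto
  have disj': "P i \<inter> P d = {}" if "i < d" for i
    using Suc.prems(2) that by (auto simp: disjoint_family_on_def)
  have off: "e \<inter> P d = {}" if "e \<in> transversals P d" for e
  proof -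
    have "e \<subseteq> (\<Union>i<d. P i)" using that by (simp add: transversals_def)
    then show ?thesis using disj' by blast
  qed
  have w: "?w (Suc d) (insert u e) = sgn_in S u * ?w d e"
    if "u \<in> P d" "e \<in> transversals P d" for u e
  proof -
    have "insert u e \<inter> P i = e \<inter> P i" if "i < d" for i
      using disj'[OF that] \<open>u \<in> P d\<close> by auto
    then have "?w d (insert u e) = ?w d e"
      by (intro prod.cong) (auto simp: part_sign_def)
    moreover have "insert u e \<inter> P d = {u}" using that off[of e] by auto
    ultimately show ?thesis by (simp add: part_sign_def sgn_in_def)
  qed
  have "form x P (Suc d) S e\<^sub>0
      = (\<Sum>u\<in>P d. \<Sum>e\<in>transversals P d. sgn_in S u * (?w d e * x (e \<union> insert u e\<^sub>0)))"
    using Suc.IH[of "insert _ e\<^sub>0"] Suc.prems(1) disj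
    by (simp add: rad_def sum_distrib_left)
  also have "\<dots> = (\<Sum>(u, e)\<in>P d \<times> transversals P d. sgn_in S u * (?w d e * x (e \<union> insert u e\<^sub>0)))"
    by (simp add: sum.cartesian_product)
  also have "\<dots> = (\<Sum>e\<in>transversals P (Suc d). ?w (Suc d) e * x (e \<union> e\<^sub>0))"
  proof (rule sum.reindex_bij_witness
      [where i = "\<lambda>e. (the_elem (e \<inter> P d), e - P d)" and j = "\<lambda>(u, e). insert u e"])
    fix a assume "a \<in> P d \<times> transversals P d"
    then obtain u e where a: "a = (u, e)" "u \<in> P d" "e \<in> transversals P d" by auto
    then have int: "insert u e \<inter> P d = {u}" "insert u e - P d = e" using off[of e] by auto
    then show "(\<lambda>e. (the_elem (e \<inter> P d), e - P d)) ((\<lambda>(u, e). insert u e) a) = a"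
      unfolding a(1) prod.case by (simp only: the_elem_eq)
    have "insert u e \<inter> P i = e \<inter> P i" if "i < d" for i
      using disj'[OF that] a by auto
    then have "card (insert u e \<inter> P i) = 1" if "i < d" for i
      using a that by (simp add: transversals_def)
    moreover have "card (insert u e \<inter> P d) = 1" unfolding int(1) by simp
    ultimately have "card (insert u e \<inter> P i) = 1" if "i < Suc d" for i
      using that by (auto simp: less_Suc_eq)
    moreover have "insert u e \<subseteq> (\<Union>i<Suc d. P i)"
      using a by (auto simp: transversals_def lessThan_Suc)
    ultimately show "(\<lambda>(u, e). insert u e) a \<in> transversals P (Suc d)"
      unfolding a(1) prod.case by (simp add: transversals_def)
    show "?w (Suc d) ((\<lambda>(u, e). insert u e) a) * x ((\<lambda>(u, e). insert u e) a \<union> e\<^sub>0)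
        = (case a of (u, e) \<Rightarrow> sgn_in S u * (?w d e * x (e \<union> insert u e\<^sub>0)))"
      unfolding a(1) prod.case w[OF a(2,3)] by (simp add: mult.assoc)
  next
    fix e assume e: "e \<in> transversals P (Suc d)"
    then have "card (e \<inter> P d) = 1" by (simp add: transversals_def)
    then obtain u where u: "e \<inter> P d = {u}" by (metis card_1_singletonE)
    then show "(\<lambda>(u, e). insert u e) ((\<lambda>e. (the_elem (e \<inter> P d), e - P d)) e) = e" by auto
    have "(e - P d) \<inter> P i = e \<inter> P i" if "i < d" for i
      using disj'[OF that] by auto
    then have "e - P d \<in> transversals P d"
      using e by (auto simp: transversals_def lessThan_Suc)
    then show "(\<lambda>e. (the_elem (e \<inter> P d), e - P d)) e \<in> P d \<times> transversals P d"
      using u by auto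
  qed
  finally show ?case .
qed

lemma prod_of_bool:
  "finite I \<Longrightarrow> (\<Prod>i\<in>I. of_bool (Q i) :: real) = of_bool (\<forall>i\<in>I. Q i)"
  by (induction I rule: finite_induct) auto

text \<open>A form is an alternating sum of discrepancies: for each set \<open>I\<close> of parts keep the positive
  vertices of the parts in \<open>I\<close> and the negative vertices of the others, and give the discrepancy of
  the resulting set the sign \<open>\<plusminus>1\<close> according to the parity of the number of parts outside \<open>I\<close>. An edge
  that misses a part is counted with both signs of that part and cancels; a transversal edge survives
  for exactly one \<open>I\<close>, with the product of its signs.\<close>

lemma decoupling:
  assumes fin: "\<And>i. i < r \<Longrightarrow> finite (P i)" and disj: "disjoint_family_on P {..<r}"
  shows "\<exists>T\<subseteq>(\<Union>i<r. P i). \<bar>form x P r S {}\<bar> / 2 ^ r \<le> \<bar>disc x r T\<bar>"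
proof -
  define U where "U = (\<Union>i<r. P i)"
  define T where "T I = {v\<in>U. \<forall>i<r. v \<in> P i \<longrightarrow> (v \<in> S \<longleftrightarrow> i \<in> I)}" for I
  have finU: "finite U" using fin by (auto simp: U_def)
  have card_e: "card e = (\<Sum>i<r. card (e \<inter> P i))" if "e \<subseteq> U" for e
  proof -
    have "e = (\<Union>i<r. e \<inter> P i)" using that by (auto simp: U_def)
    then have "card e = card (\<Union>i<r. e \<inter> P i)" by simp
    also have "\<dots> = (\<Sum>i<r. card (e \<inter> P i))"
      using fin disj by (intro card_UN_disjoint) (auto simp: disjoint_family_on_def)
    finally show ?thesis .
  qed
  have trans: "transversals P r \<subseteq> nsets U r"
  proof
    fix e assume e: "e \<in> transversals P r"
    then have "e \<subseteq> U" by (simp add: transversals_def U_def)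
    moreover have "card e = r"
      using card_e[OF \<open>e \<subseteq> U\<close>] e by (simp add: transversals_def)
    ultimately show "e \<in> nsets U r" using finU by (auto simp: nsets_def dest: finite_subset)
  qed
  have vanish: "(\<Prod>i<r. part_sign S (P i) e) = 0" if e: "e \<in> nsets U r - transversals P r" for e
  proof -
    have eU: "e \<subseteq> U" "card e = r" using e by (auto simp: nsets_def)
    obtain i where i: "i < r" "card (e \<inter> P i) \<noteq> 1"
      using e eU by (auto simp: transversals_def U_def)
    have "\<exists>i<r. card (e \<inter> P i) = 0"
    proof (rule ccontr)
      assume "\<not> ?thesis"
      then have pos: "1 \<le> card (e \<inter> P j)" if "j < r" for j
        using that by (metis One_nat_def Suc_leI gr0I)
      have "(\<Sum>j<r. 1) < (\<Sum>j<r. card (e \<inter> P j))"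
        using pos i by (intro sum_strict_mono_ex1) (auto simp: order_less_le intro!: bexI[of _ i])
      then show False using card_e[OF eU(1)] eU(2) by simp
    qed
    then obtain j where j: "j < r" "card (e \<inter> P j) = 0" by blast
    then have "e \<inter> P j = {}" using fin[of j] by (simp add: card_eq_0_iff)
    then have "part_sign S (P j) e = 0" by (simp add: part_sign_def)
    then show ?thesis using j by (auto intro: prod_zero)
  qed
  have expand: "(\<Prod>i<r. part_sign S (P i) e)
      = (\<Sum>I\<in>Pow {..<r}. (-1) ^ card ({..<r} - I) * of_bool (e \<subseteq> T I))" if "e \<in> nsets U r" for e
  proof -
    have "(\<Prod>i<r. part_sign S (P i) e)
        = (\<Prod>i<r. of_bool (e \<inter> P i \<subseteq> S) + (-1) * of_bool (e \<inter> P i \<inter> S = {}))"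
      by (simp add: part_sign_def)
    also have "\<dots> = (\<Sum>I\<in>Pow {..<r}. (\<Prod>i\<in>I. of_bool (e \<inter> P i \<subseteq> S))
        * (\<Prod>i\<in>{..<r} - I. (-1) * of_bool (e \<inter> P i \<inter> S = {})))"
      by (rule prod_add) simp
    also have "\<dots> = (\<Sum>I\<in>Pow {..<r}. (-1) ^ card ({..<r} - I) * of_bool (e \<subseteq> T I))"
    proof (rule sum.cong[OF refl])
      fix I assume I: "I \<in> Pow {..<r}"
      have "(\<Prod>i\<in>I. of_bool (e \<inter> P i \<subseteq> S) :: real) = of_bool (\<forall>i\<in>I. e \<inter> P i \<subseteq> S)"
        using I by (intro prod_of_bool) (auto intro: finite_subset)
      moreover have "(\<Prod>i\<in>{..<r} - I. of_bool (e \<inter> P i \<inter> S = {}) :: real)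
          = of_bool (\<forall>i\<in>{..<r} - I. e \<inter> P i \<inter> S = {})"
        by (rule prod_of_bool) simp
      moreover have "e \<subseteq> T I \<longleftrightarrow> (\<forall>i\<in>I. e \<inter> P i \<subseteq> S) \<and> (\<forall>i\<in>{..<r} - I. e \<inter> P i \<inter> S = {})"
        using that I by (fastforce simp: T_def nsets_def)
      ultimately show "(\<Prod>i\<in>I. of_bool (e \<inter> P i \<subseteq> S))
          * (\<Prod>i\<in>{..<r} - I. (-1) * of_bool (e \<inter> P i \<inter> S = {}))
          = (-1 :: real) ^ card ({..<r} - I) * of_bool (e \<subseteq> T I)"
        by (simp add: prod.distrib)
    qed
    finally show ?thesis .
  qed
  have nsets_T: "{e\<in>nsets U r. e \<subseteq> T I} = nsets (T I) r" for I
    by (auto simp: nsets_def T_def)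
  have "form x P r S {} = (\<Sum>e\<in>transversals P r. (\<Prod>i<r. part_sign S (P i) e) * x e)"
    using form_eq_sum_transversals[OF fin disj, of x S "{}"] by simp
  also have "\<dots> = (\<Sum>e\<in>nsets U r. (\<Prod>i<r. part_sign S (P i) e) * x e)"
    using trans vanish finU
    by (intro sum.mono_neutral_left) (auto simp: finite_imp_finite_nsets)
  also have "\<dots> = (\<Sum>e\<in>nsets U r. \<Sum>I\<in>Pow {..<r}. (-1) ^ card ({..<r} - I) * (of_bool (e \<subseteq> T I) * x e))"
    by (intro sum.cong refl) (simp only: expand sum_distrib_right mult.assoc)
  also have "\<dots> = (\<Sum>I\<in>Pow {..<r}. (-1) ^ card ({..<r} - I) * (\<Sum>e\<in>nsets U r. of_bool (e \<subseteq> T I) * x e))"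
    by (subst sum.swap) (simp add: sum_distrib_left)
  also have "\<dots> = (\<Sum>I\<in>Pow {..<r}. (-1) ^ card ({..<r} - I) * disc x r (T I))"
  proof -
    have "(\<Sum>e\<in>nsets U r. of_bool (e \<subseteq> T I) * x e) = disc x r (T I)" for I
    proof -
      have "(\<Sum>e\<in>nsets U r. of_bool (e \<subseteq> T I) * x e) = (\<Sum>e\<in>{e\<in>nsets U r. e \<subseteq> T I}. x e)"
        using finU by (simp add: sum.inter_filter finite_imp_finite_nsets of_bool_def
            if_distrib[of "\<lambda>y. y * _"] cong: if_cong)
      then show ?thesis by (simp only: nsets_T disc_def)
    qed
    then show ?thesis by simp
  qed
  finally have "\<bar>form x P r S {}\<bar> \<le> (\<Sum>I\<in>Pow {..<r}. \<bar>disc x r (T I)\<bar>)"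
    by (simp only:) (rule order_trans[OF sum_abs], simp add: abs_mult power_abs)
  moreover have "(\<Sum>I\<in>Pow {..<r}. \<bar>disc x r (T I)\<bar>) < 2 ^ r * (\<bar>form x P r S {}\<bar> / 2 ^ r)"
    if "\<forall>I. \<bar>disc x r (T I)\<bar> < \<bar>form x P r S {}\<bar> / 2 ^ r"
  proof -
    have "(\<Sum>I\<in>Pow {..<r}. \<bar>disc x r (T I)\<bar>) < (\<Sum>I\<in>Pow {..<r}. \<bar>form x P r S {}\<bar> / 2 ^ r)"
      using that by (intro sum_strict_mono) auto
    then show ?thesis by (simp add: card_Pow)
  qed
  ultimately have "\<exists>I. \<bar>form x P r S {}\<bar> / 2 ^ r \<le> \<bar>disc x r (T I)\<bar>"
    by (force simp: not_le)
  then obtain I where "\<bar>form x P r S {}\<bar> / 2 ^ r \<le> \<bar>disc x r (T I)\<bar>" ..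
  moreover have "T I \<subseteq> (\<Union>i<r. P i)" by (auto simp: T_def U_def)
  ultimately show ?thesis by blast
qed

lemma disjoint_family_on_fun_upd:
  assumes "disjoint_family_on S {..<t}" "\<And>i. i < t \<Longrightarrow> S i \<inter> Q = {}"
  shows "disjoint_family_on (S(t := Q)) {..<Suc t}"
  unfolding disjoint_family_on_def
proof (intro ballI impI)
  fix i j assume ij: "i \<in> {..<Suc t}" "j \<in> {..<Suc t}" "i \<noteq> j"
  then consider "i < t" "j < t" | "i < t" "j = t" | "i = t" "j < t" by (auto simp: less_Suc_eq)
  then show "(S(t := Q)) i \<inter> (S(t := Q)) j = {}"
  proof cases
    case 1
    then show ?thesis using assms(1) ij(3) by (auto simp: disjoint_family_on_def)
  next
    case 2
    then show ?thesis using assms(2)[of i] by simp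
  next
    case 3
    then show ?thesis using assms(2)[of j] by (simp add: Int_commute)
  qed
qed

lemma obtain_disjoint_subsets:
  fixes n :: "nat \<Rightarrow> nat"
  assumes "finite V" "(\<Sum>i<k. n i) \<le> card V"
  shows "\<exists>P. disjoint_family_on P {..<k} \<and> (\<forall>i<k. P i \<subseteq> V \<and> card (P i) = n i)"
  using assms(2)
proof (induction k)
  case 0
  then show ?case by (simp add: disjoint_family_on_def)
next
  case (Suc k)
  then obtain P where P: "disjoint_family_on P {..<k}" "\<forall>i<k. P i \<subseteq> V \<and> card (P i) = n i"
    by auto
  define U where "U = (\<Union>i<k. P i)"
  have "U \<subseteq> V" using P(2) by (auto simp: U_def)
  have "card U \<le> (\<Sum>i<k. card (P i))"
    unfolding U_def by (rule card_UN_le) simp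
  then have "card U \<le> (\<Sum>i<k. n i)" using P(2) by simp
  then have "n k \<le> card (V - U)"
    using Suc.prems \<open>U \<subseteq> V\<close> assms(1) by (simp add: card_Diff_subset finite_subset)
  then obtain Q where Q: "Q \<subseteq> V - U" "card Q = n k"
    by (meson obtain_subset_with_card_n)
  have "disjoint_family_on (P(k := Q)) {..<Suc k}"
    using P(1) Q(1) by (intro disjoint_family_on_fun_upd) (auto simp: U_def)
  moreover have "\<forall>i<Suc k. (P(k := Q)) i \<subseteq> V \<and> card ((P(k := Q)) i) = n i"
    using P(2) Q by (auto simp: less_Suc_eq)
  ultimately show ?case by blast
qed

text \<open>Double counting: some outcome is at least as good as the average one.\<close>

lemma exists_popular:
  fixes c :: real
  assumes "finite \<Omega>" "\<Omega> \<noteq> {}" "finite W"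
    and "\<And>v. v \<in> W \<Longrightarrow> c * real (card \<Omega>) \<le> real (card {\<omega>\<in>\<Omega>. R \<omega> v})"
  shows "\<exists>\<omega>\<in>\<Omega>. c * real (card W) \<le> real (card {v\<in>W. R \<omega> v})"
proof (rule ccontr)
  assume "\<not> ?thesis"
  then have "(\<Sum>\<omega>\<in>\<Omega>. real (card {v\<in>W. R \<omega> v})) < (\<Sum>\<omega>\<in>\<Omega>. c * real (card W))"
    using assms by (intro sum_strict_mono) (auto simp: not_le)
  also have "\<dots> = (\<Sum>v\<in>W. c * real (card \<Omega>))" by simp
  also have "\<dots> \<le> (\<Sum>v\<in>W. real (card {\<omega>\<in>\<Omega>. R \<omega> v}))"
    using assms by (intro sum_mono) auto
  also have "\<dots> = (\<Sum>\<omega>\<in>\<Omega>. real (card {v\<in>W. R \<omega> v}))"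
  proof -
    have "(\<Sum>v\<in>W. card {\<omega>\<in>\<Omega>. R \<omega> v}) = (\<Sum>\<omega>\<in>\<Omega>. card {v\<in>W. R \<omega> v})"
      using assms sum_multicount_gen[of W \<Omega> "\<lambda>v \<omega>. R \<omega> v" "\<lambda>\<omega>. card {v\<in>W. R \<omega> v}"]
      by simp
    then show ?thesis by (metis (mono_tags, lifting) of_nat_sum sum.cong)
  qed
  finally show False by simp
qed

section \<open>Large discrepancy in every weighting\<close>

text \<open>Random signs on \<open>r - 1\<close> disjoint sets of \<open>l\<close> vertices give each further vertex \<open>v\<close> a score,
  the signed weight of the transversal edges through \<open>v\<close>, whose standard deviation is of order
  \<open>l\<^bsup>(r-1)/2\<^esup>\<close>. Splitting one of the sets into \<open>s\<close> blocks shows that the score exceeds a constant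
  times \<open>\<surd>s l\<^bsup>(r-1)/2\<^esup>\<close> with probability at least a constant times \<open>32\<^sup>-\<^sup>s\<close>. If the number \<open>n\<close> of
  candidates for \<open>v\<close> is at least a large multiple of \<open>32\<^sup>s l\<close>, then some choice of the signs gives
  such a score to \<open>l\<close> of them. These \<open>l\<close> vertices become the last part, all with sign \<open>+1\<close>; the value
  of the form is then at least of order \<open>\<surd>s l\<^bsup>(r+1)/2\<^esup>\<close>, and decoupling turns it into discrepancy.
  Here \<open>r = d + 2\<close>, so that the recursion of forms can be unfolded twice: \<open>d\<close> parts whose signs
  only have to make the coefficients large, the part that is split into blocks, and the part of the
  \<open>l\<close> chosen vertices.\<close>

lemma large_discrepancy:
  fixes x :: "'a set \<Rightarrow> real" and d s m n :: nat and \<delta> :: real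
  defines "l \<equiv> s * m" and "\<kappa> \<equiv> \<delta> / 2 ^ d"
  assumes "finite V" "0 < s" "0 < m" "0 < \<delta>"
    and x: "\<And>e. \<bar>x e\<bar> \<le> 1" "\<And>e. \<delta> \<le> \<bar>x e\<bar>"
    and V: "Suc d * l + n \<le> card V" and n: "4 * 32 ^ s * real l \<le> \<kappa>\<^sup>2 * real n"
  shows "\<exists>T\<subseteq>V. card T \<le> (d + 2) * l \<and>
    \<kappa> / 2 ^ (d + 5) * sqrt (real s * real l ^ (d + 3)) \<le> \<bar>disc x (d + 2) T\<bar>"
proof -
  have pos: "0 < \<kappa>" "0 < l" using assms by (auto simp: \<kappa>_def l_def)
  obtain P where P: "disjoint_family_on P {..<Suc d}" "\<And>i. i < Suc d \<Longrightarrow> P i \<subseteq> V"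
      "\<And>i. i < Suc d \<Longrightarrow> card (P i) = l"
    using obtain_disjoint_subsets[OF \<open>finite V\<close>, where n = "\<lambda>_. l" and k = "Suc d"] V by auto
  have finP: "finite (P i)" if "i < Suc d" for i
    using P(2)[OF that] \<open>finite V\<close> by (rule finite_subset)
  obtain A where A: "disjoint_family_on A {..<s}" "\<And>i. i < s \<Longrightarrow> A i \<subseteq> P d"
      "\<And>i. i < s \<Longrightarrow> card (A i) = m"
    using obtain_disjoint_subsets[of "P d" "\<lambda>_. m" s] finP[of d] P(3)[of d] by (auto simp: l_def)
  have finA: "finite (A i)" if "i < s" for i
    using A(2)[OF that] finP[of d] by (auto intro: finite_subset)
  have UA: "(\<Union>i<s. A i) = P d"
  proof (rule card_subset_eq)
    have "card (\<Union>i<s. A i) = (\<Sum>i<s. card (A i))"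
      using finA A(1) by (intro card_UN_disjoint) (auto simp: disjoint_family_on_def)
    then show "card (\<Union>i<s. A i) = card (P d)" using A(3) P(3)[of d] by (simp add: l_def)
  qed (use A(2) finP in auto)
  define U where "U = (\<Union>i<d. P i)"
  have finU: "finite U" unfolding U_def using finP by auto
  have disjd: "disjoint_family_on P {..<d}"
    using P(1) by (rule disjoint_family_on_mono[rotated]) auto
  have disjPd: "U \<inter> P d = {}"
  proof -
    have "P i \<inter> P d = {}" if "i < d" for i
      using P(1) that by (auto simp: disjoint_family_on_def)
    then show ?thesis unfolding U_def by blast
  qed
  define W where "W = V - (\<Union>i<Suc d. P i)"
  have finW: "finite W" using \<open>finite V\<close> by (simp add: W_def)
  have "card (\<Union>i<Suc d. P i) \<le> (\<Sum>i<Suc d. card (P i))" by (rule card_UN_le) simp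
  also have "\<dots> = Suc d * l" using P(3) by simp
  finally have "n \<le> card W"
    using V diff_card_le_card_Diff[of "\<Union>i<Suc d. P i" V] finP unfolding W_def by fastforce

  \<comment> \<open>The signs on the first \<open>d\<close> parts are chosen such that for many \<open>v\<close> the coefficient vector
    \<open>a S v\<close> on part \<open>d\<close> has large total length \<open>L S v\<close> over the blocks.\<close>
  define a where "a S v u = form x P d S {u, v}" for S v u
  define L where "L S v = (\<Sum>i<s. sqrt (\<Sum>u\<in>A i. (a S v u)\<^sup>2))" for S v
  define \<mu> where "\<mu> = real s * (\<kappa> * sqrt (real m * real l ^ d))"
  have mu: "0 \<le> \<mu>" using pos by (simp add: \<mu>_def)
  define B where "B = real s * real l * real l ^ d"
  have Bpos: "0 < B" using pos \<open>0 < s\<close> by (simp add: B_def)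
  have muB: "\<mu>\<^sup>2 = \<kappa>\<^sup>2 * B"
    by (simp add: \<mu>_def B_def l_def power_mult_distrib power2_eq_square algebra_simps)
  have mean: "\<mu> \<le> avg U (\<lambda>S. L S v)" for v
  proof -
    define b where "b = \<kappa> * sqrt (real l ^ d)"
    have b: "0 \<le> b" using pos by (simp add: b_def)
    have "\<mu> = (\<Sum>i<s. sqrt (\<Sum>u\<in>A i. b\<^sup>2))"
      using A(3) b by (simp add: \<mu>_def b_def real_sqrt_mult)
    also have "\<dots> \<le> (\<Sum>i<s. sqrt (\<Sum>u\<in>A i. (avg U (\<lambda>S. \<bar>a S v u\<bar>))\<^sup>2))"
      unfolding b_def \<kappa>_def a_def U_def using finP disjd P(3) x(2) \<open>0 < \<delta>\<close>
      by (intro sum_mono real_sqrt_le_mono power_mono avg_abs_form_ge) auto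
    also have "\<dots> \<le> (\<Sum>i<s. avg U (\<lambda>S. sqrt (\<Sum>u\<in>A i. (a S v u)\<^sup>2)))"
      by (intro sum_mono avg_norm_ge[OF finU])
    also have "\<dots> = avg U (\<lambda>S. L S v)" by (simp add: L_def avg_sum)
    finally show ?thesis .
  qed
  have square: "avg U (\<lambda>S. (L S v)\<^sup>2) \<le> B" for v
  proof -
    have "avg U (\<lambda>S. (L S v)\<^sup>2) \<le> avg U (\<lambda>S. real s * (\<Sum>u\<in>P d. (a S v u)\<^sup>2))"
    proof (rule avg_mono)
      fix S
      have L: "L S v \<le> sqrt (\<Sum>i<s. 1\<^sup>2) * sqrt (\<Sum>i<s. (sqrt (\<Sum>u\<in>A i. (a S v u)\<^sup>2))\<^sup>2)"
        using cauchy_schwarz_sum[of "\<lambda>_. 1" "\<lambda>i. sqrt (\<Sum>u\<in>A i. (a S v u)\<^sup>2)" "{..<s}"]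
        by (simp add: L_def)
      have "0 \<le> L S v" by (simp add: L_def sum_nonneg)
      then have "(L S v)\<^sup>2
          \<le> (sqrt (\<Sum>i<s. 1\<^sup>2) * sqrt (\<Sum>i<s. (sqrt (\<Sum>u\<in>A i. (a S v u)\<^sup>2))\<^sup>2))\<^sup>2"
        by (intro power_mono L)
      also have "\<dots> = real s * (\<Sum>i<s. \<Sum>u\<in>A i. (a S v u)\<^sup>2)"
        by (simp add: power_mult_distrib sum_nonneg)
      also have "(\<Sum>i<s. \<Sum>u\<in>A i. (a S v u)\<^sup>2) = (\<Sum>u\<in>P d. (a S v u)\<^sup>2)"
        unfolding UA[symmetric] using finA A(1)
        by (intro sum.UNION_disjoint[symmetric]) (auto simp: disjoint_family_on_def)
      finally show "(L S v)\<^sup>2 \<le> real s * (\<Sum>u\<in>P d. (a S v u)\<^sup>2)" .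
    qed
    also have "\<dots> = real s * (\<Sum>u\<in>P d. avg U (\<lambda>S. (a S v u)\<^sup>2))"
      by (simp only: avg_cmult avg_sum)
    also have "\<dots> \<le> real s * (\<Sum>u\<in>P d. real l ^ d)"
      unfolding a_def U_def using finP disjd P(3) x(1)
      by (intro mult_left_mono sum_mono avg_form_square_le) auto
    also have "\<dots> = B" using P(3)[of d] by (simp add: B_def)
    finally show ?thesis .
  qed
  have "\<exists>S\<in>Pow U. \<kappa>\<^sup>2 / 4 * real (card W) \<le> real (card {v\<in>W. \<mu> / 2 \<le> L S v})"
  proof (rule exists_popular)
    fix v
    have "(\<mu> / 2)\<^sup>2 * real (card (Pow U)) \<le> B * real (card {S\<in>Pow U. \<mu> / 2 \<le> L S v})"
    proof (rule paley_zygmund)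
      show "\<mu> * real (card (Pow U)) \<le> (\<Sum>S\<in>Pow U. L S v)"
        using mean[of v] finU by (simp add: avg_def card_Pow field_simps)
      show "(\<Sum>S\<in>Pow U. (L S v)\<^sup>2) \<le> B * real (card (Pow U))"
        using square[of v] finU by (simp add: avg_def card_Pow field_simps)
    qed (use finU mu in \<open>auto simp: L_def sum_nonneg\<close>)
    then have "B * (\<kappa>\<^sup>2 / 4 * real (card (Pow U))) \<le> B * real (card {S\<in>Pow U. \<mu> / 2 \<le> L S v})"
      by (simp add: power_divide muB mult_ac)
    then show "\<kappa>\<^sup>2 / 4 * real (card (Pow U)) \<le> real (card {S\<in>Pow U. \<mu> / 2 \<le> L S v})"
      using Bpos by (simp only: mult_le_cancel_left_pos)
  qed (use finU finW in auto)
  then obtain S where S: "S \<subseteq> U"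
      and W': "\<kappa>\<^sup>2 / 4 * real (card W) \<le> real (card {v\<in>W. \<mu> / 2 \<le> L S v})"
    by blast
  define W' where "W' = {v\<in>W. \<mu> / 2 \<le> L S v}"

  \<comment> \<open>The signs on part \<open>d\<close> are chosen such that many of these \<open>v\<close> gain on all blocks at once.\<close>
  have "\<exists>T\<in>Pow (P d). 1 / 32 ^ s * real (card W')
      \<le> real (card {v\<in>W'. L S v / 4 \<le> rad (a S v) (P d) T})"
  proof (rule exists_popular)
    fix v
    have "2 ^ card (P d) \<le> 32 ^ s * real (card {T\<in>Pow (P d). L S v / 4 \<le> rad (a S v) (P d) T})"
      using rad_large_blocks[of "{..<s}" A "a S v"] finA A(1) by (simp add: UA L_def)
    then show "1 / 32 ^ s * real (card (Pow (P d)))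
        \<le> real (card {T\<in>Pow (P d). L S v / 4 \<le> rad (a S v) (P d) T})"
      using finP[of d] by (simp add: card_Pow field_simps)
  qed (use finP[of d] finW in \<open>auto simp: W'_def\<close>)
  then obtain T where T: "T \<subseteq> P d"
      and Bs: "1 / 32 ^ s * real (card W') \<le> real (card {v\<in>W'. L S v / 4 \<le> rad (a S v) (P d) T})"
    by blast
  have "real l \<le> 1 / 32 ^ s * (\<kappa>\<^sup>2 / 4 * real n)"
    using n by (simp add: field_simps)
  also have "\<dots> \<le> 1 / 32 ^ s * (\<kappa>\<^sup>2 / 4 * real (card W))"
    using \<open>n \<le> card W\<close> by (intro mult_left_mono) auto
  also have "\<dots> \<le> 1 / 32 ^ s * real (card W')"
    using W' by (intro mult_left_mono) (auto simp: W'_def)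
  also note Bs
  finally have "l \<le> card {v\<in>W'. L S v / 4 \<le> rad (a S v) (P d) T}" by simp
  then obtain C where C: "C \<subseteq> {v\<in>W'. L S v / 4 \<le> rad (a S v) (P d) T}" "card C = l"
    by (meson obtain_subset_with_card_n)
  have CW: "C \<subseteq> W" using C(1) by (auto simp: W'_def)
  have finC: "finite C" using CW finW by (rule finite_subset)

  define Q where "Q = P(Suc d := C)"
  define R where "R = S \<union> T \<union> C"
  have CP: "C \<inter> P i = {}" if "i < Suc d" for i
    using CW that by (auto simp: W_def)
  have CU: "C \<inter> U = {}" "C \<inter> P d = {}"
    using CW by (auto simp: U_def W_def less_Suc_eq)
  have disjQ: "disjoint_family_on Q {..<Suc (Suc d)}"
    unfolding Q_def using P(1) CP by (intro disjoint_family_on_fun_upd) (auto simp: Int_commute)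
  have Q: "Q i \<subseteq> V" "card (Q i) = l" if "i < Suc (Suc d)" for i
    using that P(2,3) CW C(2) by (auto simp: Q_def W_def less_Suc_eq)
  have finQ: "finite (Q i)" if "i < Suc (Suc d)" for i
    using Q(1)[OF that] \<open>finite V\<close> by (rule finite_subset)
  have score: "\<mu> / 8 \<le> form x Q (Suc d) R {v}" if "v \<in> C" for v
  proof -
    have "form x Q d R {u, v} = a S v u" for u
    proof -
      have "form x Q d R {u, v} = form x P d R {u, v}"
        by (rule form_parts_cong) (simp add: Q_def)
      also have "\<dots> = form x P d S {u, v}"
        using CU T disjPd by (intro form_cong) (auto simp: R_def U_def)
      finally show ?thesis by (simp add: a_def)
    qed
    moreover have "rad (a S v) (P d) R = rad (a S v) (P d) T"
      using CU S T disjPd by (intro rad_cong) (auto simp: R_def)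
    ultimately have "form x Q (Suc d) R {v} = rad (a S v) (P d) T"
      by (simp add: Q_def)
    moreover have "\<mu> / 2 \<le> L S v" "L S v / 4 \<le> rad (a S v) (P d) T"
      using C(1) that by (auto simp: W'_def)
    ultimately show ?thesis by simp
  qed
  have "\<kappa> / 8 * sqrt (real s * real l ^ (d + 3)) = real l * (\<mu> / 8)"
  proof -
    have "real l * \<mu> = \<kappa> * (real l * (real s * sqrt (real m * real l ^ d)))"
      by (simp add: \<mu>_def)
    also have "real l * (real s * sqrt (real m * real l ^ d))
        = sqrt ((real l)\<^sup>2 * ((real s)\<^sup>2 * (real m * real l ^ d)))"
      by (simp add: real_sqrt_mult)
    also have "(real l)\<^sup>2 * ((real s)\<^sup>2 * (real m * real l ^ d)) = real s * real l ^ (d + 3)"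
      by (simp add: l_def power_add power2_eq_square power3_eq_cube mult_ac)
    finally show ?thesis by simp
  qed
  also have "\<dots> = (\<Sum>v\<in>C. \<mu> / 8)" using C(2) by simp
  also have "\<dots> \<le> (\<Sum>v\<in>C. form x Q (Suc d) R {v})"
    by (intro sum_mono score)
  also have "\<dots> = (\<Sum>v\<in>C. sgn_in R v * form x Q (Suc d) R {v})"
    by (intro sum.cong) (auto simp: sgn_in_def R_def)
  also have "\<dots> = form x Q (d + 2) R {}"
    by (simp add: rad_def Q_def del: form.simps(2)) (simp only: form.simps(2) rad_def, simp)
  finally have form: "\<kappa> / 8 * sqrt (real s * real l ^ (d + 3)) \<le> \<bar>form x Q (d + 2) R {}\<bar>"
    by linarith
  obtain Z where Z: "Z \<subseteq> (\<Union>i<d + 2. Q i)" "\<bar>form x Q (d + 2) R {}\<bar> / 2 ^ (d + 2) \<le> \<bar>disc x (d + 2) Z\<bar>"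
    using decoupling[of "d + 2" Q x R] finQ disjQ by (auto simp: numeral_2_eq_2)
  have "card Z \<le> card (\<Union>i<d + 2. Q i)"
    using Z(1) finQ by (intro card_mono) auto
  also have "\<dots> \<le> (\<Sum>i<d + 2. card (Q i))" by (rule card_UN_le) simp
  also have "\<dots> = (d + 2) * l" using Q(2) by simp
  finally have "card Z \<le> (d + 2) * l" .
  moreover have "Z \<subseteq> V" using Z(1) Q(1) by fastforce
  moreover have "\<kappa> / 2 ^ (d + 5) * sqrt (real s * real l ^ (d + 3))
      \<le> \<bar>disc x (d + 2) Z\<bar>"
  proof -
    have "(2::real) ^ (d + 5) = 8 * 2 ^ (d + 2)" by (simp add: power_add)
    then have "\<kappa> / 2 ^ (d + 5) * sqrt (real s * real l ^ (d + 3))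
        = \<kappa> / 8 * sqrt (real s * real l ^ (d + 3)) / 2 ^ (d + 2)"
      by (simp only: times_divide_eq_left divide_divide_eq_left mult.assoc)
    also have "\<dots> \<le> \<bar>form x Q (d + 2) R {}\<bar> / 2 ^ (d + 2)"
      by (rule divide_right_mono[OF form]) simp
    finally show ?thesis using Z(2) by (rule order_trans)
  qed
  ultimately show ?thesis by blast
qed

section \<open>Unions of disjoint sets\<close>

text \<open>By induction on the degree: for a polynomial \<open>G\<close> of degree \<open>r\<close> without constant term,
  \<open>2\<^sup>r G(p/2) - G(p)\<close> has smaller degree, is bounded by \<open>2\<^sup>r + 1\<close> times the bound on \<open>G\<close>, and its
  linear coefficient is that of \<open>G\<close> times \<open>2\<^bsup>r-1\<^esup> - 1\<close>.\<close>


lemma linear_coefficient_bound: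
  fixes r :: nat
  assumes "1 \<le> r"
  shows "\<exists>C>0. \<forall>(a :: nat \<Rightarrow> real) M.
    (\<forall>p\<in>{0..1}. \<bar>\<Sum>m=1..r. a m * p ^ m\<bar> \<le> M) \<longrightarrow> \<bar>a 1\<bar> \<le> C * M"
  using assms
proof (induction r rule: nat_induct_at_least)
  case base
  have "\<bar>a 1\<bar> \<le> 1 * M" if "\<forall>p\<in>{0..1}. \<bar>\<Sum>m=1..1. a m * p ^ m\<bar> \<le> M" for a :: "nat \<Rightarrow> real" and M
    using bspec[OF that, of 1] by simp
  then show ?case by (intro exI[of _ 1]) auto
next
  case (Suc r)
  then obtain C where C: "C > 0"
    "\<And>(a :: nat \<Rightarrow> real) M. \<forall>p\<in>{0..1}. \<bar>\<Sum>m=1..r. a m * p ^ m\<bar> \<le> M \<Longrightarrow> \<bar>a 1\<bar> \<le> C * M"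
    by blast
  have "\<bar>a 1\<bar> \<le> C * (2 ^ Suc r + 1) * M"
    if a: "\<forall>p\<in>{0..1}. \<bar>\<Sum>m=1..Suc r. a m * p ^ m\<bar> \<le> M" for a :: "nat \<Rightarrow> real" and M
  proof -
    define G where "G p = (\<Sum>m=1..Suc r. a m * p ^ m)" for p
    define b where "b m = (2 ^ (Suc r - m) - 1) * a m" for m
    have "\<bar>\<Sum>m=1..r. b m * p ^ m\<bar> \<le> (2 ^ Suc r + 1) * M" if p: "p \<in> {0..1}" for p
    proof -
      have "(\<Sum>m=1..r. b m * p ^ m) = (\<Sum>m=1..Suc r. b m * p ^ m)"
        by (simp add: b_def)
      also have "\<dots> = 2 ^ Suc r * G (p / 2) - G p"
        unfolding G_def sum_distrib_left sum_subtractf[symmetric]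
        by (intro sum.cong) (auto simp: b_def power_diff power_divide field_simps)
      finally have "\<bar>\<Sum>m=1..r. b m * p ^ m\<bar> \<le> 2 ^ Suc r * \<bar>G (p / 2)\<bar> + \<bar>G p\<bar>"
        by (simp only:) (rule order_trans[OF abs_triangle_ineq4], simp add: abs_mult)
      moreover have "\<bar>G (p / 2)\<bar> \<le> M" "\<bar>G p\<bar> \<le> M"
        using p unfolding G_def by (intro bspec[OF a]; simp)+
      then have "2 ^ Suc r * \<bar>G (p / 2)\<bar> + \<bar>G p\<bar> \<le> 2 ^ Suc r * M + M"
        by (intro add_mono mult_left_mono) auto
      ultimately show ?thesis by (simp add: algebra_simps)
    qed
    then have "\<bar>b 1\<bar> \<le> C * ((2 ^ Suc r + 1) * M)" by (intro C(2)) auto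
    moreover have "1 * \<bar>a 1\<bar> \<le> (2 ^ r - 1) * \<bar>a 1\<bar>"
      using Suc.hyps self_le_power[of "2::real" r] by (intro mult_right_mono) auto
    then have "\<bar>a 1\<bar> \<le> \<bar>b 1\<bar>" by (simp add: b_def abs_mult)
    ultimately show ?thesis by (simp add: mult.assoc)
  qed
  then show ?case using C(1) by (intro exI[of _ "C * (2 ^ Suc r + 1)"]) (auto simp: add_pos_pos)
qed

text \<open>Keep each of the sets \<open>S i\<close> independently with probability \<open>p\<close>. The expected discrepancy of the
  union of the kept sets is a polynomial in \<open>p\<close>; its linear coefficient comes from the edges that lie
  inside a single \<open>S i\<close>. So if no union has large discrepancy, the discrepancies
  of the \<open>S i\<close> cannot add up either, whatever the edges between different \<open>S i\<close> contribute.\<close>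

lemma sum_disc_le:
  fixes r :: nat
  assumes r: "1 \<le> r"
  shows "\<exists>C>0. \<forall>(x :: 'a set \<Rightarrow> real) (I :: nat set) S M. finite I \<and> (\<forall>i\<in>I. finite (S i)) \<and>
    disjoint_family_on S I \<and> (\<forall>J\<subseteq>I. \<bar>disc x r (\<Union>i\<in>J. S i)\<bar> \<le> M) \<longrightarrow>
    \<bar>\<Sum>i\<in>I. disc x r (S i)\<bar> \<le> C * M"
proof -
  obtain C where C: "C > 0"
    "\<And>(a :: nat \<Rightarrow> real) M. \<forall>p\<in>{0..1}. \<bar>\<Sum>m=1..r. a m * p ^ m\<bar> \<le> M \<Longrightarrow> \<bar>a 1\<bar> \<le> C * M"
    using linear_coefficient_bound[OF r] by blast
  have "\<bar>\<Sum>i\<in>I. disc x r (S i)\<bar> \<le> C * M"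
    if fin: "finite I" "\<forall>i\<in>I. finite (S i)" and disj: "disjoint_family_on S I"
      and M: "\<forall>J\<subseteq>I. \<bar>disc x r (\<Union>i\<in>J. S i)\<bar> \<le> M"
    for x :: "'a set \<Rightarrow> real" and I :: "nat set" and S M
  proof -
    define U where "U = (\<Union>i\<in>I. S i)"
    define N where "N = nsets U r"
    define K where "K e = {i\<in>I. e \<inter> S i \<noteq> {}}" for e
    define a where "a m = (\<Sum>e\<in>{e\<in>N. card (K e) = m}. x e)" for m
    have finU: "finite U" using fin by (auto simp: U_def)
    have finN: "finite N" using finU by (simp add: N_def finite_imp_finite_nsets)
    have finK: "finite (K e)" for e using fin by (simp add: K_def)
    have K: "card (K e) \<in> {1..r}" if "e \<in> N" for e
    proof -
      have e: "e \<subseteq> U" "finite e" "card e = r" using that by (auto simp: N_def nsets_def)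
      then obtain v where "v \<in> e" using r by fastforce
      then have "K e \<noteq> {}" using e(1) by (fastforce simp: K_def U_def)
      moreover have "\<forall>i\<in>K e. \<exists>v. v \<in> e \<inter> S i" by (auto simp: K_def)
      then obtain g where g: "\<And>i. i \<in> K e \<Longrightarrow> g i \<in> e \<inter> S i" by metis
      have "inj_on g (K e)"
      proof (rule inj_onI)
        fix i j assume ij: "i \<in> K e" "j \<in> K e" "g i = g j"
        then have "S i \<inter> S j \<noteq> {}" using g by fastforce
        then show "i = j" using ij disj by (auto simp: disjoint_family_on_def K_def)
      qed
      then have "card (K e) \<le> card e"
        using g e by (intro card_inj_on_le[of g]) auto
      ultimately show ?thesis using e finK[of e] by (simp add: Suc_le_eq card_gt_0_iff)
    qed
    have "\<bar>\<Sum>m=1..r. a m * p ^ m\<bar> \<le> M" if p: "p \<in> {0..1}" for p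
    proof -
      define w where "w J = p ^ card J * (1 - p) ^ card (I - J)" for J
      have w: "0 \<le> w J" for J using p by (simp add: w_def)
      have total: "(\<Sum>J\<in>Pow I. w J) = 1"
        using prod_add[OF fin(1), of "\<lambda>_. p" "\<lambda>_. 1 - p"] by (simp add: w_def)
      have prob: "(\<Sum>J\<in>Pow I. w J * of_bool (K e \<subseteq> J)) = p ^ card (K e)" for e
      proof -
        have "(\<Sum>J\<in>Pow I. w J * of_bool (K e \<subseteq> J))
            = (\<Sum>J\<in>Pow I. (\<Prod>i\<in>J. p) * (\<Prod>i\<in>I - J. of_bool (i \<notin> K e) * (1 - p)))"
        proof (rule sum.cong[OF refl])
          fix J assume J: "J \<in> Pow I"
          have "(\<Prod>i\<in>I - J. of_bool (i \<notin> K e)) = (of_bool (\<forall>i\<in>I - J. i \<notin> K e) :: real)"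
            using fin by (intro prod_of_bool) auto
          moreover have "(\<forall>i\<in>I - J. i \<notin> K e) \<longleftrightarrow> K e \<subseteq> J" by (auto simp: K_def)
          ultimately show "w J * of_bool (K e \<subseteq> J)
              = (\<Prod>i\<in>J. p) * (\<Prod>i\<in>I - J. of_bool (i \<notin> K e) * (1 - p))"
            by (simp add: w_def prod.distrib)
        qed
        also have "\<dots> = (\<Prod>i\<in>I. p + of_bool (i \<notin> K e) * (1 - p))"
          by (rule prod_add[OF fin(1), symmetric])
        also have "\<dots> = (\<Prod>i\<in>I. if i \<in> K e then p else 1)" by (intro prod.cong) auto
        also have "\<dots> = (\<Prod>i\<in>{i\<in>I. i \<in> K e}. p)"
          by (rule prod.inter_filter[OF fin(1), symmetric])
        also have "{i\<in>I. i \<in> K e} = K e" by (auto simp: K_def)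
        finally show ?thesis by simp
      qed
      have "(\<Sum>m=1..r. a m * p ^ m) = (\<Sum>m=1..r. \<Sum>e\<in>{e\<in>N. card (K e) = m}. x e * p ^ card (K e))"
        by (simp add: a_def sum_distrib_right)
      also have "\<dots> = (\<Sum>e\<in>N. x e * p ^ card (K e))"
        using finN K by (intro sum.group) auto
      also have "\<dots> = (\<Sum>e\<in>N. \<Sum>J\<in>Pow I. w J * (of_bool (K e \<subseteq> J) * x e))"
        by (simp only: prob[symmetric] sum_distrib_left mult_ac)
      also have "\<dots> = (\<Sum>J\<in>Pow I. w J * (\<Sum>e\<in>N. of_bool (K e \<subseteq> J) * x e))"
        by (subst sum.swap) (simp only: sum_distrib_left)
      also have "\<dots> = (\<Sum>J\<in>Pow I. w J * disc x r (\<Union>i\<in>J. S i))"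
      proof (rule sum.cong[OF refl])
        fix J assume J: "J \<in> Pow I"
        have "K e \<subseteq> J \<longleftrightarrow> e \<subseteq> (\<Union>i\<in>J. S i)" if "e \<in> N" for e
        proof
          assume "K e \<subseteq> J"
          then show "e \<subseteq> (\<Union>i\<in>J. S i)"
            using that by (fastforce simp: N_def nsets_def U_def K_def)
        next
          assume e: "e \<subseteq> (\<Union>i\<in>J. S i)"
          show "K e \<subseteq> J"
          proof
            fix i assume "i \<in> K e"
            then obtain v where v: "v \<in> e" "v \<in> S i" "i \<in> I" by (auto simp: K_def)
            then obtain j where "j \<in> J" "v \<in> S j" using e by blast
            moreover have "S i \<inter> S j = {}" if "i \<noteq> j"
              using disj v(3) J \<open>j \<in> J\<close> that by (auto simp: disjoint_family_on_def)
            ultimately show "i \<in> J" using v(2) by blast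
          qed
        qed
        then have "(\<Sum>e\<in>N. of_bool (K e \<subseteq> J) * x e)
            = (\<Sum>e\<in>N. if e \<subseteq> (\<Union>i\<in>J. S i) then x e else 0)"
          by (intro sum.cong) auto
        also have "\<dots> = (\<Sum>e\<in>{e\<in>N. e \<subseteq> (\<Union>i\<in>J. S i)}. x e)"
          by (rule sum.inter_filter[OF finN, symmetric])
        also have "{e\<in>N. e \<subseteq> (\<Union>i\<in>J. S i)} = nsets (\<Union>i\<in>J. S i) r"
        proof -
          have "(\<Union>i\<in>J. S i) \<subseteq> U" using J by (auto simp: U_def)
          then show ?thesis by (auto simp: N_def nsets_def)
        qed
        finally show "w J * (\<Sum>e\<in>N. of_bool (K e \<subseteq> J) * x e) = w J * disc x r (\<Union>i\<in>J. S i)"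
          by (simp add: disc_def)
      qed
      also have "\<bar>\<dots>\<bar> \<le> (\<Sum>J\<in>Pow I. w J * \<bar>disc x r (\<Union>i\<in>J. S i)\<bar>)"
        by (rule order_trans[OF sum_abs]) (simp add: abs_mult w)
      also have "\<dots> \<le> (\<Sum>J\<in>Pow I. w J * M)"
        using M w by (intro sum_mono mult_left_mono) auto
      also have "\<dots> = M" using total by (simp flip: sum_distrib_right)
      finally show ?thesis .
    qed
    then have "\<bar>a 1\<bar> \<le> C * M" by (intro C(2)) blast
    moreover have "a 1 = (\<Sum>i\<in>I. disc x r (S i))"
    proof -
      have "{e\<in>N. card (K e) = 1} = (\<Union>i\<in>I. nsets (S i) r)"
      proof (intro set_eqI iffI)
        fix e assume "e \<in> {e\<in>N. card (K e) = 1}"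
        then have e: "e \<in> nsets U r" "card (K e) = 1" by (auto simp: N_def)
        then obtain i where i: "K e = {i}" by (metis card_1_singletonE)
        then have "e \<subseteq> S i" using e(1) by (fastforce simp: K_def nsets_def U_def)
        moreover have "i \<in> I" using i by (auto simp: K_def)
        ultimately show "e \<in> (\<Union>i\<in>I. nsets (S i) r)" using e(1) by (auto simp: nsets_def)
      next
        fix e assume "e \<in> (\<Union>i\<in>I. nsets (S i) r)"
        then obtain i where i: "i \<in> I" "e \<in> nsets (S i) r" by blast
        then have "e \<in> N" by (auto simp: N_def U_def nsets_def)
        moreover have "K e \<subseteq> {i}"
        proof
          fix j assume "j \<in> K e"
          then have "S i \<inter> S j \<noteq> {}" "j \<in> I" using i by (auto simp: K_def nsets_def)
          moreover have "S i \<inter> S j = {}" if "j \<in> I" "j \<noteq> i"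
            using i(1) disj that by (auto simp: disjoint_family_on_def)
          ultimately show "j \<in> {i}" by blast
        qed
        then have "card (K e) \<le> 1" using card_mono[of "{i}" "K e"] by simp
        ultimately show "e \<in> {e\<in>N. card (K e) = 1}" using K[of e] by auto
      qed
      moreover have "nsets (S i) r \<inter> nsets (S j) r = {}" if "i \<in> I" "j \<in> I" "i \<noteq> j" for i j
      proof -
        have "S i \<inter> S j = {}" using disj that by (auto simp: disjoint_family_on_def)
        then have "e = {} \<and> card e = r" if "e \<in> nsets (S i) r" "e \<in> nsets (S j) r" for e
          using that by (auto simp: nsets_def)
        then show ?thesis using r by fastforce
      qed
      ultimately show ?thesis
        unfolding a_def disc_def using fin
        by (simp add: sum.UNION_disjoint finite_imp_finite_nsets)
    qed
    ultimately show ?thesis by simp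
  qed
  then show ?thesis using C(1) by blast
qed

section \<open>Discrepancy and minimum degree\<close>

text \<open>With these weights the discrepancy of \<open>S\<close> is the number of edges of colour \<open>j\<close> inside \<open>S\<close> minus
  the share \<open>\<rho> j\<close> of all edges inside \<open>S\<close>. Defining the weight of all sets, not
  only of edges, makes it bounded away from \<open>0\<close> everywhere, as \<open>large_discrepancy\<close> demands.\<close>

definition colour_weight :: "(nat \<Rightarrow> real) \<Rightarrow> ('a set \<Rightarrow> nat) \<Rightarrow> nat \<Rightarrow> 'a set \<Rightarrow> real" where
  "colour_weight \<rho> c j e = of_bool (c e = j) - \<rho> j"

abbreviation cdisc :: "(nat \<Rightarrow> real) \<Rightarrow> ('a set \<Rightarrow> nat) \<Rightarrow> nat \<Rightarrow> nat \<Rightarrow> 'a set \<Rightarrow> real" where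
  "cdisc \<rho> c r j S \<equiv> disc (colour_weight \<rho> c j) r S"

lemma card_nsets: "finite S \<Longrightarrow> card (nsets S r) = card S choose r"
proof -
  assume "finite S"
  then have "nsets S r = {B. B \<subseteq> S \<and> card B = r}"
    by (auto simp: nsets_def intro: finite_subset)
  then show ?thesis using \<open>finite S\<close> by (simp add: n_subsets)
qed

lemma cdisc_eq:
  assumes "finite S"
  shows "cdisc \<rho> c r j S = real (card {e\<in>nsets S r. c e = j}) - \<rho> j * real (card S choose r)"
  using assms by (simp add: disc_def colour_weight_def sum_subtractf of_bool_def finite_imp_finite_nsets
      card_nsets flip: sum.inter_filter)

lemma cdisc_le_power:
  assumes "finite S" "0 \<le> \<rho> j" "1 \<le> r"
  shows "cdisc \<rho> c r j S \<le> real (card S) ^ r"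
proof -
  have "card {e\<in>nsets S r. c e = j} \<le> card S choose r"
    unfolding card_nsets[OF assms(1), symmetric]
    using assms(1) by (intro card_mono) (auto simp: finite_imp_finite_nsets)
  also have "\<dots> \<le> card S ^ r"
    by (cases "r \<le> card S") (auto simp: binomial_le_pow binomial_eq_0)
  finally have "real (card {e\<in>nsets S r. c e = j}) \<le> real (card S) ^ r"
    by (simp flip: of_nat_power)
  moreover have "0 \<le> \<rho> j * real (card S choose r)" using assms(2) by simp
  ultimately show ?thesis unfolding cdisc_eq[OF assms(1)] by linarith
qed

lemma sum_cdisc_eq_0:
  assumes "finite S" "\<And>e. e \<in> nsets S r \<Longrightarrow> c e \<in> {1..q}" "(\<Sum>j=1..q. \<rho> j) = 1"
  shows "(\<Sum>j=1..q. cdisc \<rho> c r j S) = 0"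
proof -
  have "(\<Sum>j=1..q. cdisc \<rho> c r j S) = (\<Sum>e\<in>nsets S r. \<Sum>j=1..q. colour_weight \<rho> c j e)"
    unfolding disc_def by (rule sum.swap)
  also have "\<dots> = (\<Sum>e\<in>nsets S r. 0)"
    using assms(2,3) by (intro sum.cong) (auto simp: colour_weight_def sum_subtractf of_bool_def)
  finally show ?thesis by simp
qed

text \<open>The discrepancies of a set in the different colours sum to \<open>0\<close>, so a deficiency in one colour is
  a surplus in the others.\<close>


lemma exists_colour_cdisc_ge:
  assumes "finite S" "\<And>e. e \<in> nsets S r \<Longrightarrow> c e \<in> {1..q}" "(\<Sum>j=1..q. \<rho> j) = 1"
    and "j\<^sub>0 \<in> {1..q}" "X \<le> \<bar>cdisc \<rho> c r j\<^sub>0 S\<bar>" "0 < X"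
  shows "\<exists>j\<in>{1..q}. X / real q \<le> cdisc \<rho> c r j S"
proof (rule ccontr)
  assume "\<not> ?thesis"
  then have less: "cdisc \<rho> c r j S < X / real q" if "j \<in> {1..q}" for j
    using that by (auto simp: not_le)
  have q: "real q \<ge> 1" using assms(4) by simp
  have "X / real q \<le> X" using q assms(6) by (simp add: divide_le_eq)
  then have neg: "cdisc \<rho> c r j\<^sub>0 S \<le> - X" using less[OF assms(4)] assms(5) by linarith
  have "0 = cdisc \<rho> c r j\<^sub>0 S + (\<Sum>j\<in>{1..q} - {j\<^sub>0}. cdisc \<rho> c r j S)"
    using sum_cdisc_eq_0[OF assms(1-3)] assms(4) by (simp add: sum.remove[of _ j\<^sub>0])
  also have "\<dots> \<le> - X + (\<Sum>j\<in>{1..q} - {j\<^sub>0}. X / real q)"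
    using neg less by (intro add_mono sum_mono) (auto intro: less_imp_le)
  also have "\<dots> = - (X / real q)" using assms(4) q by (simp add: of_nat_diff field_simps)
  finally show False using assms(6) q by (simp add: field_simps)
qed

lemma degree_eq_cdisc_diff:
  assumes "finite V" "S \<subseteq> V" "v \<in> S" "1 \<le> r"
  shows "real (Defs.degree (colour_induced (complete_hypergraph r V) c j S) v)
    = cdisc \<rho> c r j S - cdisc \<rho> c r j (S - {v}) + \<rho> j * real ((card S - 1) choose (r - 1))"
proof -
  have fin: "finite S" using assms finite_subset by blast
  let ?E = "\<lambda>S. {e\<in>nsets S r. c e = j}"
  let ?D = "{e\<in>?E S. v \<in> e}"
  have "?E S = ?E (S - {v}) \<union> ?D" by (auto simp: nsets_def)
  then have "card (?E S) = card (?E (S - {v}) \<union> ?D)" by (rule arg_cong)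
  also have "\<dots> = card (?E (S - {v})) + card ?D"
    using fin by (intro card_Un_disjoint) (auto simp: finite_imp_finite_nsets nsets_def)
  finally have "card (?E S) = card (?E (S - {v})) + card ?D" .
  moreover have "?D = {e \<in> snd (colour_induced (complete_hypergraph r V) c j S). v \<in> e}"
    using assms by (auto simp: colour_induced_def complete_hypergraph_def nsets_def)
  then have "card ?D = Defs.degree (colour_induced (complete_hypergraph r V) c j S) v"
    by (simp add: Defs.degree_def)
  moreover have "card S choose r = ((card S - 1) choose r) + ((card S - 1) choose (r - 1))"
    using assms fin card_gt_0_iff[of S] by (cases "card S"; cases r) auto
  moreover have "card (S - {v}) = card S - 1" using assms fin by simp
  moreover have "finite (S - {v})" using fin by simp
  ultimately show ?thesis
    unfolding cdisc_eq[OF fin] cdisc_eq[OF \<open>finite (S - {v})\<close>]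
    by (simp only: of_nat_add) (simp only: algebra_simps)
qed

text \<open>Deleting a vertex \<open>v\<close> lowers the discrepancy by the excess of the degree of \<open>v\<close> over
  \<open>\<rho> j * ((card S - 1) choose (r - 1))\<close>. So if the penalised discrepancy cannot be increased by a
  deletion, then each degree exceeds this number by at least the increment of the penalty \<open>f\<close>.\<close>

lemma min_degree_ge_if_maximal:
  assumes "finite V" "S \<subseteq> V" "S \<noteq> {}" "1 \<le> r"
    and max: "\<And>v. v \<in> S \<Longrightarrow> cdisc \<rho> c r j (S - {v}) - f (card S - 1) \<le> cdisc \<rho> c r j S - f (card S)"
  shows "\<rho> j * real ((card S - 1) choose (r - 1)) + (f (card S) - f (card S - 1))
    \<le> real (min_degree (colour_induced (complete_hypergraph r V) c j S))"
proof -
  let ?H = "colour_induced (complete_hypergraph r V) c j S"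
  have "finite S" using assms finite_subset by blast
  moreover have "fst ?H = S" by (simp add: colour_induced_def)
  ultimately have "min_degree ?H \<in> Defs.degree ?H ` S"
    using assms(3) unfolding min_degree_def by (metis Min_in finite_imageI image_is_empty)
  then obtain v where "v \<in> S" "min_degree ?H = Defs.degree ?H v" by blast
  then show ?thesis
    using max[of v] degree_eq_cdisc_diff[OF assms(1,2), of v r c j \<rho>] assms(4) by simp
qed

lemma exists_maximal_cdisc:
  fixes f :: "nat \<Rightarrow> real"
  assumes "finite V" "1 \<le> q"
  shows "\<exists>j\<in>{1..q}. \<exists>S\<subseteq>V. \<forall>j'\<in>{1..q}. \<forall>S'\<subseteq>V.
    cdisc \<rho> c r j' S' - f (card S') \<le> cdisc \<rho> c r j S - f (card S)"
proof -
  define g where "g = (\<lambda>(j, S). cdisc \<rho> c r j S - f (card S))"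
  define Z where "Z = {1..q} \<times> Pow V"
  have Z: "finite (g ` Z)" "g ` Z \<noteq> {}" using assms by (auto simp: Z_def)
  then obtain z where "z \<in> Z" "Max (g ` Z) = g z" by (meson Max_in imageE)
  then obtain j S where jS: "j \<in> {1..q}" "S \<subseteq> V" "g (j, S) = Max (g ` Z)"
    by (cases z) (auto simp: Z_def)
  have "g (j', S') \<le> g (j, S)" if "j' \<in> {1..q}" "S' \<subseteq> V" for j' S'
    unfolding jS(3) using that Z(1) by (intro Max_ge) (auto simp: Z_def)
  then show ?thesis
    using jS(1,2) unfolding g_def by (intro bexI[of _ j] exI[of _ S] conjI ballI allI impI) auto
qed

text \<open>The required set is a maximiser of the penalised discrepancy over all colours and all subsets.
  It has at least \<open>k\<close> vertices because its discrepancy is at least \<open>k\<^sup>r\<close>, and \<open>l\<close> vertices span at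
  most \<open>l\<^sup>r\<close> edges.\<close>

lemma exists_large_min_degree:
  fixes f :: "nat \<Rightarrow> real"
  assumes "finite V" "1 \<le> q" "1 \<le> r" "1 \<le> k" and \<rho>: "\<And>j. j \<in> {1..q} \<Longrightarrow> 0 \<le> \<rho> j"
    and f: "\<And>m. 0 \<le> f m"
    and "j\<^sub>0 \<in> {1..q}" "S\<^sub>0 \<subseteq> V" "real k ^ r \<le> cdisc \<rho> c r j\<^sub>0 S\<^sub>0 - f (card S\<^sub>0)"
  shows "\<exists>j\<in>{1..q}. \<exists>S\<subseteq>V. k \<le> card S \<and>
    \<rho> j * real ((card S - 1) choose (r - 1)) + (f (card S) - f (card S - 1))
    \<le> real (min_degree (colour_induced (complete_hypergraph r V) c j S))"
proof -
  obtain j S where j: "j \<in> {1..q}" and S: "S \<subseteq> V"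
    and max: "\<And>j' S'. j' \<in> {1..q} \<Longrightarrow> S' \<subseteq> V \<Longrightarrow>
      cdisc \<rho> c r j' S' - f (card S') \<le> cdisc \<rho> c r j S - f (card S)"
    using exists_maximal_cdisc[OF assms(1,2), of \<rho> c r f] by blast
  have finS: "finite S" using S assms(1) by (rule finite_subset)
  have "real k ^ r \<le> cdisc \<rho> c r j S"
    using max[OF assms(7,8)] assms(9) f[of "card S"] by linarith
  also have "\<dots> \<le> real (card S) ^ r"
    using finS \<rho>[OF j] assms(3) by (rule cdisc_le_power)
  finally have "k \<le> card S"
    using assms(3) by (simp flip: of_nat_power add: power_mono_iff)
  moreover have "\<rho> j * real ((card S - 1) choose (r - 1)) + (f (card S) - f (card S - 1))
    \<le> real (min_degree (colour_induced (complete_hypergraph r V) c j S))"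
  proof (rule min_degree_ge_if_maximal[OF assms(1) S _ assms(3)])
    show "S \<noteq> {}" using \<open>k \<le> card S\<close> assms(4) by auto
    fix v assume "v \<in> S"
    then show "cdisc \<rho> c r j (S - {v}) - f (card S - 1) \<le> cdisc \<rho> c r j S - f (card S)"
      using max[OF j, of "S - {v}"] S finS by auto
  qed
  ultimately show ?thesis using j S by blast
qed

section \<open>Dense monochromatic subsets in every colouring\<close>

text \<open>The weight of the first colour has large absolute discrepancy on some set; if it is negative there,
  another colour makes up for it.\<close>


lemma exists_large_cdisc:
  fixes r q :: nat and \<rho> :: "nat \<Rightarrow> real"
  assumes r: "2 \<le> r" and q: "1 \<le> q" and \<rho>: "\<And>i. i \<in> {1..q} \<Longrightarrow> 0 < \<rho> i \<and> \<rho> i < 1"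
    and sum: "(\<Sum>i=1..q. \<rho> i) = 1"
  shows "\<exists>\<beta>>0. \<exists>\<gamma>>0. \<forall>(V :: 'a set) c s m n. finite V \<and> (\<forall>e\<in>nsets V r. c e \<in> {1..q}) \<and>
    0 < s \<and> 0 < m \<and> r * (s * m) + n \<le> card V \<and> 32 ^ s * real (s * m) \<le> \<beta> * real n \<longrightarrow>
    (\<exists>T\<subseteq>V. card T \<le> r * (s * m) \<and>
      (\<exists>j\<in>{1..q}. \<gamma> * sqrt (real s * real (s * m) ^ (r + 1)) \<le> cdisc \<rho> c r j T))"
proof -
  define \<delta> where "\<delta> = min (\<rho> 1) (1 - \<rho> 1)"
  define \<kappa> where "\<kappa> = \<delta> / 2 ^ (r - 2)"
  define \<gamma> where "\<gamma> = \<kappa> / 2 ^ (r + 3)"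
  have \<rho>1: "0 < \<rho> 1" "\<rho> 1 < 1" using \<rho>[of 1] q by auto
  then have \<delta>: "0 < \<delta>" by (simp add: \<delta>_def)
  then have pos: "0 < \<kappa>" "0 < \<gamma>" by (auto simp: \<kappa>_def \<gamma>_def)
  have "\<exists>T\<subseteq>V. card T \<le> r * (s * m) \<and>
      (\<exists>j\<in>{1..q}. \<gamma> / real q * sqrt (real s * real (s * m) ^ (r + 1)) \<le> cdisc \<rho> c r j T)"
    if V: "finite V" and c: "\<forall>e\<in>nsets V r. c e \<in> {1..q}" and sm: "0 < s" "0 < m"
      and n: "r * (s * m) + n \<le> card V" "32 ^ s * real (s * m) \<le> \<kappa>\<^sup>2 / 4 * real n"
    for V :: "'a set" and c s m n
  proof -
    let ?X = "\<gamma> * sqrt (real s * real (s * m) ^ (r + 1))"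
    have d: "Suc (r - 2) = r - 1" "r - 2 + 2 = r" "r - 2 + 5 = r + 3" "r - 2 + 3 = r + 1"
      using r by auto
    have "\<exists>T\<subseteq>V. card T \<le> (r - 2 + 2) * (s * m) \<and> \<delta> / 2 ^ (r - 2) / 2 ^ (r - 2 + 5) *
      sqrt (real s * real (s * m) ^ (r - 2 + 3)) \<le> \<bar>disc (colour_weight \<rho> c 1) (r - 2 + 2) T\<bar>"
    proof (rule large_discrepancy[OF V sm \<delta>])
      show "\<bar>colour_weight \<rho> c 1 e\<bar> \<le> 1" "\<delta> \<le> \<bar>colour_weight \<rho> c 1 e\<bar>" for e
        using \<rho>1 by (auto simp: colour_weight_def \<delta>_def)
      have "Suc (r - 2) * (s * m) \<le> r * (s * m)"
        unfolding d(1) by (intro mult_le_mono1) simp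
      then show "Suc (r - 2) * (s * m) + n \<le> card V" using n(1) by linarith
      show "4 * 32 ^ s * real (s * m) \<le> (\<delta> / 2 ^ (r - 2))\<^sup>2 * real n"
        using n(2) by (simp add: \<kappa>_def)
    qed
    then obtain T where T: "T \<subseteq> V" "card T \<le> r * (s * m)" "?X \<le> \<bar>cdisc \<rho> c r 1 T\<bar>"
      unfolding d \<kappa>_def[symmetric] \<gamma>_def[symmetric] by blast
    have "\<exists>j\<in>{1..q}. ?X / real q \<le> cdisc \<rho> c r j T"
    proof (rule exists_colour_cdisc_ge[OF _ _ sum _ T(3)])
      show "finite T" using T(1) V by (rule finite_subset)
      show "c e \<in> {1..q}" if "e \<in> nsets T r" for e
        using c that nsets_mono[OF T(1), of r] by blast
      show "0 < ?X" using pos sm by simp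
    qed (use q in auto)
    then show ?thesis using T(1,2) by auto
  qed
  note main = this
  have "0 < \<kappa>\<^sup>2 / 4" "0 < \<gamma> / real q" using pos q by auto
  then show ?thesis
    by (intro exI[of _ "\<kappa>\<^sup>2 / 4"] exI[of _ "\<gamma> / real q"] conjI allI impI; (elim conjE)?)
       (assumption | rule main)+
qed

lemma sum_sqrt_le:
  fixes \<nu> :: real
  assumes "0 \<le> \<nu>" "t \<le> L" "1 \<le> r"
  shows "(\<Sum>i=1..t. \<nu> * sqrt (real i ^ (r - 1) * ln (real i))) \<le> \<nu> * sqrt (real L ^ (r + 1) * ln (real L))"
proof (cases "L = 0")
  case True
  then show ?thesis using assms by simp
next
  case False
  then have L: "1 \<le> real L" by simp
  have "(\<Sum>i=1..t. \<nu> * sqrt (real i ^ (r - 1) * ln (real i)))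
      \<le> (\<Sum>i=1..t. \<nu> * sqrt (real L ^ (r - 1) * ln (real L)))"
    using assms by (intro sum_mono mult_left_mono real_sqrt_le_mono mult_mono power_mono) auto
  also have "\<dots> = real t * (\<nu> * sqrt (real L ^ (r - 1) * ln (real L)))" by simp
  also have "\<dots> \<le> real L * (\<nu> * sqrt (real L ^ (r - 1) * ln (real L)))"
    using assms L by (intro mult_right_mono) auto
  also have "\<dots> = \<nu> * sqrt ((real L)\<^sup>2 * (real L ^ (r - 1) * ln (real L)))"
    by (simp add: real_sqrt_mult)
  also have "(real L)\<^sup>2 * (real L ^ (r - 1) * ln (real L)) = real L ^ (r + 1) * ln (real L)"
  proof -
    have "r + 1 = 2 + (r - 1)" using assms(3) by simp
    then show ?thesis by (simp only: power_add mult.assoc)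
  qed
  finally show ?thesis .
qed

text \<open>If the number of vertices is a sufficiently large power of \<open>k\<close>, then a set of at most \<open>r l\<close>
  vertices has discrepancy of order \<open>\<surd>(s l\<^bsup>r+1\<^esup>)\<close>, where \<open>s\<close> is as large a multiple of \<open>ln k\<close> as
  desired and \<open>l = s k\<^sup>2\<close>. This beats the penalty \<open>f\<close> whose increments are the required surplus of
  degree: on such a set \<open>f\<close> is at most of order \<open>\<nu> \<surd>(l\<^bsup>r+1\<^esup> ln k)\<close>. The factor \<open>k\<^sup>2\<close> in \<open>l\<close> makes the
  remaining discrepancy at least \<open>k\<^sup>r\<close>.\<close>


lemma min_degree_with_surplus:
  fixes r q :: nat and \<rho> :: "nat \<Rightarrow> real" and \<nu> :: real
  assumes r: "2 \<le> r" and q: "1 \<le> q" and \<rho>: "\<And>i. i \<in> {1..q} \<Longrightarrow> 0 < \<rho> i \<and> \<rho> i < 1"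
    and sum: "(\<Sum>i=1..q. \<rho> i) = 1" and \<nu>: "0 < \<nu>"
  shows "\<exists>K>0. \<forall>\<^sub>F k in sequentially. \<forall>(V :: 'a set) c.
    finite V \<and> (\<forall>e\<in>nsets V r. c e \<in> {1..q}) \<and> real k powr K \<le> real (card V) \<longrightarrow>
    (\<exists>j\<in>{1..q}. \<exists>S\<subseteq>V. k \<le> card S \<and>
      \<rho> j * real ((card S - 1) choose (r - 1)) + \<nu> * sqrt (real (card S) ^ (r - 1) * ln (real (card S)))
      \<le> real (min_degree (colour_induced (complete_hypergraph r V) c j S)))"
proof -
  obtain \<beta> \<gamma> where \<beta>: "0 < \<beta>" and \<gamma>: "0 < \<gamma>"
    and disc: "\<And>(V :: 'a set) c s m n. finite V \<Longrightarrow> \<forall>e\<in>nsets V r. c e \<in> {1..q} \<Longrightarrow>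
    0 < s \<Longrightarrow> 0 < m \<Longrightarrow> r * (s * m) + n \<le> card V \<Longrightarrow> 32 ^ s * real (s * m) \<le> \<beta> * real n \<Longrightarrow>
    \<exists>T\<subseteq>V. card T \<le> r * (s * m) \<and>
      (\<exists>j\<in>{1..q}. \<gamma> * sqrt (real s * real (s * m) ^ (r + 1)) \<le> cdisc \<rho> c r j T)"
    using exists_large_cdisc[of r q \<rho>, OF r q \<rho> sum] by metis
  (* This value of A makes the penalty at most half of the discrepancy. *)
  define A where "A = 12 * \<nu>\<^sup>2 * real r ^ (r + 1) / \<gamma>\<^sup>2"
  have A: "0 < A" using \<nu> \<gamma> r by (simp add: A_def)
  define K where "K = 5 + A * ln 32"
  have K: "0 < K" using A by (simp add: K_def add_pos_pos)
  define f where "f L = (\<Sum>i=1..L. \<nu> * sqrt (real i ^ (r - 1) * ln (real i)))" for L :: nat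
  have f: "0 \<le> f L" for L
    unfolding f_def using \<nu> by (intro sum_nonneg mult_nonneg_nonneg) auto
  have "\<forall>\<^sub>F k in sequentially. real r * (A * ln (real k) + 1) \<le> real k"
    using A r by real_asymp
  moreover have "\<forall>\<^sub>F k in sequentially. 2 \<le> \<gamma> * real k" using \<gamma> by real_asymp
  moreover have "\<forall>\<^sub>F k in sequentially. 32 \<le> \<beta> * real k" using \<beta> by real_asymp
  moreover have "\<forall>\<^sub>F k in sequentially. (2::nat) \<le> k" by (rule eventually_ge_at_top)
  ultimately have "\<forall>\<^sub>F k in sequentially. \<forall>(V :: 'a set) c.
    finite V \<and> (\<forall>e\<in>nsets V r. c e \<in> {1..q}) \<and> real k powr K \<le> real (card V) \<longrightarrow>
    (\<exists>j\<in>{1..q}. \<exists>S\<subseteq>V. k \<le> card S \<and>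
      \<rho> j * real ((card S - 1) choose (r - 1)) + \<nu> * sqrt (real (card S) ^ (r - 1) * ln (real (card S)))
      \<le> real (min_degree (colour_induced (complete_hypergraph r V) c j S)))"
  proof eventually_elim
    case (elim k)
    have k: "2 \<le> k" "1 \<le> real k" using elim by auto
    define s where "s = nat \<lceil>A * ln (real k)\<rceil>"
    define l where "l = s * k\<^sup>2"
    have Alnk: "0 < A * ln (real k)" using A elim(4) by simp
    have s: "A * ln (real k) \<le> real s" "real s \<le> A * ln (real k) + 1" "0 < s"
      using Alnk unfolding s_def by linarith+
    have "real r * real s \<le> real k"
      using mult_left_mono[OF s(2), of "real r"] elim(1) by simp
    then have rs: "r * s \<le> k" by (simp flip: of_nat_mult)
    have l1: "k\<^sup>2 \<le> l" using s(3) by (simp add: l_def)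
    have rl: "r * l \<le> k ^ 3"
      using mult_right_mono[OF rs, of "k\<^sup>2"] by (simp add: l_def power3_eq_cube power2_eq_square mult.assoc)
    have l3: "l \<le> k ^ 3" using rl r by (cases r) auto
    have exp_s: "(32::real) ^ s \<le> 32 * real k powr (A * ln 32)"
    proof -
      have "(32::real) ^ s = exp (real s * ln 32)"
        by (simp add: exp_of_nat_mult)
      also have "\<dots> \<le> exp ((A * ln (real k) + 1) * ln 32)"
        using s(2) by (simp add: mult_right_mono)
      also have "\<dots> = 32 * real k powr (A * ln 32)"
        using k by (simp add: powr_def algebra_simps exp_add)
      finally show ?thesis .
    qed
    show ?case
    proof (intro allI impI, elim conjE)
      fix V :: "'a set" and c
      assume V: "finite V" and c: "\<forall>e\<in>nsets V r. c e \<in> {1..q}"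
        and big: "real k powr K \<le> real (card V)"
      define p where "p = real k powr (A * ln 32)"
      have p: "1 \<le> p" using k A by (auto simp: p_def intro!: ge_one_powr_ge_zero)
      have pK: "real k powr K = real k ^ 5 * p"
        using k powr_realpow[of "real k" 5] by (simp add: K_def p_def powr_add)
      have k5: "real k ^ 4 * p + real k ^ 3 \<le> real k ^ 5 * p"
      proof -
        have "real k ^ 3 * 1 \<le> real k ^ 4 * p"
          using k p by (intro mult_mono power_increasing) auto
        then have "real k ^ 4 * p + real k ^ 3 \<le> 2 * (real k ^ 4 * p)" by linarith
        also have "\<dots> \<le> real k * (real k ^ 4 * p)"
          using k p by (intro mult_right_mono) auto
        also have "\<dots> = real k ^ 5 * p" by (simp add: power_numeral_reduce)
        finally show ?thesis .
      qed
      have rlk: "real (r * l) \<le> real k ^ 3"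
        unfolding of_nat_power[symmetric] of_nat_le_iff by (rule rl)
      have lk: "real l \<le> real k ^ 3" "(real k)\<^sup>2 \<le> real l"
        unfolding of_nat_power[symmetric] of_nat_le_iff by (rule l3, rule l1)
      have "0 \<le> real k ^ 4 * p" using p by simp
      then have "real (r * l) \<le> real (card V)" using rlk k5 big unfolding pK by linarith
      then have rlV: "r * l \<le> card V" by (simp only: of_nat_le_iff)
      define n where "n = card V - r * l"
      have n: "real k ^ 4 * p \<le> real n"
        using rlk k5 big unfolding pK n_def of_nat_diff[OF rlV] by linarith
      have "32 ^ s * real l \<le> 32 * p * real k ^ 3"
        using exp_s lk(1) p by (intro mult_mono) (auto simp: p_def)
      also have "\<dots> \<le> \<beta> * real k * p * real k ^ 3"
        using elim(3) p by (intro mult_right_mono) auto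
      also have "\<dots> = \<beta> * (real k ^ 4 * p)" by (simp add: power_numeral_reduce)
      also have "\<dots> \<le> \<beta> * real n" using n \<beta> by (intro mult_left_mono) auto
      finally have "32 ^ s * real (s * k\<^sup>2) \<le> \<beta> * real n" by (simp only: l_def)
      moreover have "r * (s * k\<^sup>2) + n \<le> card V" using rlV by (simp add: n_def l_def)
      ultimately obtain T j where T: "T \<subseteq> V" "card T \<le> r * l" and j: "j \<in> {1..q}"
        and D: "\<gamma> * sqrt (real s * real l ^ (r + 1)) \<le> cdisc \<rho> c r j T"
        using disc[OF V c s(3), of "k\<^sup>2" n] k(1) unfolding l_def by (metis zero_less_power pos2 order_less_le_trans)
      define Y where "Y = sqrt (real s * real l ^ (r + 1))"
      have "f (card T) \<le> \<nu> * sqrt (real (r * l) ^ (r + 1) * ln (real (r * l)))"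
        unfolding f_def using \<nu> T(2) r by (intro sum_sqrt_le) auto
      also have "\<dots> \<le> \<nu> * sqrt (real (r * l) ^ (r + 1) * (3 * (real s / A)))"
      proof -
        have "ln (real (r * l)) \<le> ln (real k ^ 3)"
          using rlk r s(3) k by (subst ln_le_cancel_iff) (auto simp: l_def)
        also have "\<dots> = 3 * ln (real k)" using k by (simp add: ln_realpow)
        also have "\<dots> \<le> 3 * (real s / A)" using s(1) A by (simp add: field_simps)
        finally show ?thesis
          using \<nu> by (intro mult_left_mono real_sqrt_le_mono) auto
      qed
      also have "\<dots> = \<nu> * sqrt (3 * real r ^ (r + 1) / A) * Y"
        by (simp add: Y_def power_mult_distrib flip: real_sqrt_mult)
      also have "\<nu> * sqrt (3 * real r ^ (r + 1) / A) = \<gamma> / 2"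
      proof -
        have "3 * real r ^ (r + 1) / A = (\<gamma> / (2 * \<nu>))\<^sup>2"
          using \<nu> \<gamma> r by (simp add: A_def field_simps power2_eq_square)
        then have "sqrt (3 * real r ^ (r + 1) / A) = \<gamma> / (2 * \<nu>)"
          using \<nu> \<gamma> by simp
        then show ?thesis using \<nu> by simp
      qed
      finally have fT: "f (card T) \<le> \<gamma> / 2 * Y" .
      have "1 * real k ^ r \<le> \<gamma> / 2 * real k * real k ^ r"
        using elim(2) by (intro mult_right_mono) auto
      also have "\<dots> = \<gamma> / 2 * sqrt (((real k)\<^sup>2) ^ (r + 1))"
      proof -
        have "((real k)\<^sup>2) ^ (r + 1) = (real k ^ (r + 1))\<^sup>2"
          by (simp only: power_mult[symmetric] mult.commute)
        then have "sqrt (((real k)\<^sup>2) ^ (r + 1)) = real k ^ (r + 1)"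
          by (simp only: real_sqrt_abs abs_of_nonneg zero_le_power of_nat_0_le_iff)
        then show ?thesis by (simp only: power_add power_one_right mult_ac)
      qed
      also have "\<dots> \<le> \<gamma> / 2 * Y"
      proof -
        have "((real k)\<^sup>2) ^ (r + 1) \<le> real l ^ (r + 1)"
          using lk(2) by (intro power_mono) auto
        also have "\<dots> \<le> real s * real l ^ (r + 1)"
          using s(3) mult_right_mono[of 1 "real s" "real l ^ (r + 1)"] by simp
        finally show ?thesis unfolding Y_def using \<gamma> by simp
      qed
      finally have "real k ^ r \<le> \<gamma> / 2 * Y" by (simp only: mult_1_left)
      then have "real k ^ r \<le> cdisc \<rho> c r j T - f (card T)"
        using fT D unfolding Y_def[symmetric] by simp
      moreover have "0 \<le> \<rho> i" if "i \<in> {1..q}" for i using \<rho>[OF that] by simp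
      ultimately obtain j' S where S: "j' \<in> {1..q}" "S \<subseteq> V" "k \<le> card S"
        "\<rho> j' * real ((card S - 1) choose (r - 1)) + (f (card S) - f (card S - 1))
        \<le> real (min_degree (colour_induced (complete_hypergraph r V) c j' S))"
        using exists_large_min_degree[of V q r k \<rho> f j T c] V q r k f j T(1) by auto
      have "f (card S) - f (card S - 1)
          = \<nu> * sqrt (real (card S) ^ (r - 1) * ln (real (card S)))"
        using S(3) k unfolding f_def by (cases "card S") auto
      then show "\<exists>j\<in>{1..q}. \<exists>S\<subseteq>V. k \<le> card S \<and>
        \<rho> j * real ((card S - 1) choose (r - 1)) + \<nu> * sqrt (real (card S) ^ (r - 1) * ln (real (card S)))
        \<le> real (min_degree (colour_induced (complete_hypergraph r V) c j S))"
        using S by metis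
    qed
  qed
  with K show ?thesis by (intro exI[of _ K] conjI)
qed

text \<open>Without surplus the exponent \<open>2r/(r+1)\<close> is just enough for discrepancy \<open>\<gamma> k\<^sup>r\<close>, but with a
  constant \<open>\<gamma>\<close> that may be too small to exclude that all maximisers have fewer than \<open>k\<close> vertices. If
  they do, then removing a maximiser hardly changes the number of vertices, and so there are
  arbitrarily many disjoint sets with discrepancy \<open>\<gamma> k\<^sup>r\<close> each. Some union of them must then have
  discrepancy much larger than \<open>k\<^sup>r\<close>, and the maximiser is large after all.\<close>

lemma min_degree_without_surplus:
  fixes r q :: nat and \<rho> :: "nat \<Rightarrow> real"
  assumes r: "2 \<le> r" and q: "1 \<le> q" and \<rho>: "\<And>i. i \<in> {1..q} \<Longrightarrow> 0 < \<rho> i \<and> \<rho> i < 1"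
    and sum: "(\<Sum>i=1..q. \<rho> i) = 1"
  shows "\<forall>\<^sub>F k in sequentially. \<forall>(V :: 'a set) c.
    finite V \<and> (\<forall>e\<in>nsets V r. c e \<in> {1..q}) \<and>
    real k powr (2 * real r / (real r + 1)) \<le> real (card V) \<longrightarrow>
    (\<exists>j\<in>{1..q}. \<exists>S\<subseteq>V. k \<le> card S \<and> \<rho> j * real ((card S - 1) choose (r - 1))
      \<le> real (min_degree (colour_induced (complete_hypergraph r V) c j S)))"
proof -
  obtain \<beta> \<gamma> where \<beta>: "0 < \<beta>" and \<gamma>: "0 < \<gamma>"
    and disc: "\<And>(V :: 'a set) c s m n. finite V \<Longrightarrow> \<forall>e\<in>nsets V r. c e \<in> {1..q} \<Longrightarrow>
    0 < s \<Longrightarrow> 0 < m \<Longrightarrow> r * (s * m) + n \<le> card V \<Longrightarrow> 32 ^ s * real (s * m) \<le> \<beta> * real n \<Longrightarrow>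
    \<exists>T\<subseteq>V. card T \<le> r * (s * m) \<and>
      (\<exists>j\<in>{1..q}. \<gamma> * sqrt (real s * real (s * m) ^ (r + 1)) \<le> cdisc \<rho> c r j T)"
    using exists_large_cdisc[of r q \<rho>, OF r q \<rho> sum] by metis
  have "1 \<le> r" using r by simp
  from sum_disc_le[OF this, where 'a = 'a] obtain C where C: "0 < C" and
    sum_disc: "\<forall>(x :: 'a set \<Rightarrow> real) (I :: nat set) S M. finite I \<and> (\<forall>i\<in>I. finite (S i)) \<and>
      disjoint_family_on S I \<and> (\<forall>J\<subseteq>I. \<bar>disc x r (\<Union>i\<in>J. S i)\<bar> \<le> M) \<longrightarrow>
      \<bar>\<Sum>i\<in>I. disc x r (S i)\<bar> \<le> C * M"
    by (elim exE conjE)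
  (* A set W with m = card W div G leaves n = card W - r * m vertices with 32 * m \<le> \<beta> * n. *)
  obtain G :: nat where G: "real r + 32 / \<beta> \<le> real G" by (meson real_arch_simple)
  have Gr: "r \<le> G" "0 < G" "32 / \<beta> \<le> real (G - r)"
  proof -
    have "0 < 32 / \<beta>" using \<beta> by simp
    then have "real r \<le> real G" using G by linarith
    then show "r \<le> G" by simp
    then show "0 < G" "32 / \<beta> \<le> real (G - r)" using r G by (auto simp: of_nat_diff)
  qed
  (* the constant for sets W with at least half of the vertices, where m is at least N / (4 * G) *)
  define \<gamma>' where "\<gamma>' = \<gamma> / sqrt ((4 * real G) ^ (r + 1))"
  have \<gamma>': "0 < \<gamma>'" using \<gamma> Gr by (simp add: \<gamma>'_def)
  (* so many disjoint sets that their discrepancies cannot add up *)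
  obtain t :: nat where t: "real q * (C * real q) / \<gamma>' < real t" by (meson reals_Archimedean2)
  have "\<forall>\<^sub>F k in sequentially. 2 * real t * real k + 4 * real G \<le> real k powr (4 / 3)"
    by real_asymp
  moreover have "\<forall>\<^sub>F k in sequentially. (1::nat) \<le> k" by (rule eventually_ge_at_top)
  ultimately show ?thesis
  proof eventually_elim
    case (elim k)
    have k: "1 \<le> real k" using elim(2) by simp
    show ?case
    proof (intro allI impI, elim conjE, rule ccontr)
      fix V :: "'a set" and c
      assume V: "finite V" and c: "\<forall>e\<in>nsets V r. c e \<in> {1..q}"
        and big: "real k powr (2 * real r / (real r + 1)) \<le> real (card V)"
        and "\<not> (\<exists>j\<in>{1..q}. \<exists>S\<subseteq>V. k \<le> card S \<and> \<rho> j * real ((card S - 1) choose (r - 1))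
          \<le> real (min_degree (colour_induced (complete_hypergraph r V) c j S)))"
      then have none: "\<not> \<rho> j * real ((card S - 1) choose (r - 1))
          \<le> real (min_degree (colour_induced (complete_hypergraph r V) c j S))"
        if "j \<in> {1..q}" "S \<subseteq> V" "k \<le> card S" for j S using that by blast
      define N where "N = card V"
      have "4 / 3 \<le> 2 * real r / (real r + 1)" using r by (simp add: field_simps)
      then have "real k powr (4 / 3) \<le> real N"
        using powr_mono[of "4 / 3" "2 * real r / (real r + 1)" "real k"] k big
        unfolding N_def by linarith
      then have N: "2 * real t * real k + 4 * real G \<le> real N" using elim(1) by linarith
      have "real k ^ r \<le> sqrt (real N ^ (r + 1))"
      proof (rule real_le_rsqrt)
        have "(real k ^ r)\<^sup>2 = real k powr real (2 * r)"
          using k by (simp only: powr_realpow power_mult[symmetric] mult.commute)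
        also have "real (2 * r) = 2 * real r / (real r + 1) * real (r + 1)"
        proof -
          have *: "real (r + 1) = real r + 1" "real r + 1 \<noteq> 0" by simp_all
          show ?thesis unfolding *(1) using *(2) by (metis nonzero_eq_divide_eq of_nat_mult of_nat_numeral)
        qed
        also have "real k powr (2 * real r / (real r + 1) * real (r + 1))
            = (real k powr (2 * real r / (real r + 1))) ^ (r + 1)"
          unfolding powr_powr[symmetric] using k by (intro powr_realpow) simp
        also have "\<dots> \<le> real N ^ (r + 1)"
          using big unfolding N_def by (intro power_mono) auto
        finally show "(real k ^ r)\<^sup>2 \<le> real N ^ (r + 1)" .
      qed
      moreover have "\<gamma>' * sqrt (real N ^ (r + 1)) = \<gamma> * sqrt ((real N / (4 * real G)) ^ (r + 1))"
        by (simp only: \<gamma>'_def power_divide real_sqrt_divide) simp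
      ultimately have kN: "\<gamma>' * real k ^ r \<le> \<gamma> * sqrt ((real N / (4 * real G)) ^ (r + 1))"
        using mult_left_mono[of "real k ^ r" "sqrt (real N ^ (r + 1))" \<gamma>'] \<gamma>' by linarith

      have half: "\<exists>j\<in>{1..q}. \<exists>T\<subseteq>W. \<gamma>' * real k ^ r \<le> cdisc \<rho> c r j T"
        if W: "W \<subseteq> V" "real N \<le> 2 * real (card W)" for W
      proof -
        define m where "m = card W div G"
        define n where "n = card W - r * m"
        have finW: "finite W" using W(1) V by (rule finite_subset)
        have "real (card W) < real ((m + 1) * G)"
          unfolding m_def of_nat_less_iff using Gr(2)
          by (metis Suc_eq_plus1 dividend_less_times_div mult.commute mult_Suc_right add.commute)
        then have "real (card W) < (real m + 1) * real G" by (simp add: algebra_simps)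
        moreover have "0 \<le> real t * real k" by simp
        ultimately have "real N / 2 < (real m + 1) * real G" "2 * real G \<le> real N / 2"
          using W(2) N by linarith+
        then have "2 * real G < (real m + 1) * real G" by linarith
        then have "1 < real m"
          using Gr(2) by (simp add: mult_less_cancel_right)
        then have m: "0 < m" by simp
        have "(real m + 1) * real G \<le> 2 * real m * real G"
          using \<open>1 < real m\<close> by (intro mult_right_mono) auto
        then have "real N \<le> real m * (4 * real G)"
          using \<open>real N / 2 < (real m + 1) * real G\<close> by linarith
        then have "real N / (4 * real G) \<le> real m"
          using Gr(2) by (simp add: pos_divide_le_eq)
        have Gm: "G * m \<le> card W" unfolding m_def by simp
        then have rm: "r * m \<le> card W" using Gr(1) mult_le_mono1 order_trans by blast
        have "(G - r) * m \<le> n"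
          using Gm unfolding n_def by (simp add: diff_mult_distrib)
        then have "real (G - r) * real m \<le> real n" by (simp flip: of_nat_mult)
        moreover have "32 / \<beta> * real m \<le> real (G - r) * real m"
          using Gr(3) by (intro mult_right_mono) auto
        ultimately have "32 / \<beta> * real m \<le> real n" by linarith
        then have "32 * real m \<le> \<beta> * real n" using \<beta> by (simp add: field_simps)
        moreover have "\<forall>e\<in>nsets W r. c e \<in> {1..q}"
          using c nsets_mono[OF W(1), of r] by blast
        ultimately obtain T j where T: "T \<subseteq> W" "j \<in> {1..q}"
          "\<gamma> * sqrt (real m ^ (r + 1)) \<le> cdisc \<rho> c r j T"
          using disc[OF finW, of c 1 m n] m rm by (auto simp: n_def)
        have "sqrt ((real N / (4 * real G)) ^ (r + 1)) \<le> sqrt (real m ^ (r + 1))"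
          using \<open>real N / (4 * real G) \<le> real m\<close> by (intro real_sqrt_le_mono power_mono) auto
        then have "\<gamma> * sqrt ((real N / (4 * real G)) ^ (r + 1)) \<le> \<gamma> * sqrt (real m ^ (r + 1))"
          using \<gamma> by (intro mult_left_mono) auto
        then have "\<gamma>' * real k ^ r \<le> cdisc \<rho> c r j T" using kN T(3) by linarith
        then show ?thesis using T(1,2) by blast
      qed

      have small: "\<bar>cdisc \<rho> c r j S\<bar> \<le> real q * real k ^ r" if j: "j \<in> {1..q}" and S: "S \<subseteq> V" for j S
      proof (rule ccontr)
        assume "\<not> ?thesis"
        then have "real q * real k ^ r \<le> \<bar>cdisc \<rho> c r j S\<bar>" by simp
        moreover have "0 < real q * real k ^ r" using q k by simp
        moreover have "finite S" using S V by (rule finite_subset)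
        moreover have "c e \<in> {1..q}" if "e \<in> nsets S r" for e
          using c that nsets_mono[OF S, of r] by blast
        ultimately obtain i where i: "i \<in> {1..q}" "real q * real k ^ r / real q \<le> cdisc \<rho> c r i S"
          using exists_colour_cdisc_ge[OF _ _ sum j, of S r c] by blast
        have "\<exists>j\<in>{1..q}. \<exists>S\<subseteq>V. k \<le> card S \<and>
          \<rho> j * real ((card S - 1) choose (r - 1)) + ((\<lambda>_. 0) (card S) - (\<lambda>_. 0) (card S - 1))
          \<le> real (min_degree (colour_induced (complete_hypergraph r V) c j S))"
          using V q r elim(2) \<rho> i S by (intro exists_large_min_degree) (auto intro: less_imp_le)
        then show False using none by auto
      qed

      have "\<exists>S J. disjoint_family_on S {..<t'} \<and> (\<forall>i<t'. S i \<subseteq> V \<and> card (S i) < k \<and>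
          J i \<in> {1..q} \<and> \<gamma>' * real k ^ r \<le> cdisc \<rho> c r (J i) (S i))" if "t' \<le> t" for t'
        using that
      proof (induction t')
        case 0
        then show ?case by (simp add: disjoint_family_on_def)
      next
        case (Suc t')
        then obtain S J where disj: "disjoint_family_on S {..<t'}"
          and SJ: "\<forall>i<t'. S i \<subseteq> V \<and> card (S i) < k \<and> J i \<in> {1..q} \<and>
            \<gamma>' * real k ^ r \<le> cdisc \<rho> c r (J i) (S i)"
          by auto
        define U where "U = (\<Union>i<t'. S i)"
        define W where "W = V - U"
        have W: "W \<subseteq> V" by (auto simp: W_def)
        have "U \<subseteq> V" using SJ by (auto simp: U_def)
        then have cardW: "card W = N - card U"
          using V unfolding W_def N_def by (intro card_Diff_subset) (auto intro: finite_subset)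
        have "card U \<le> (\<Sum>i<t'. card (S i))" unfolding U_def by (rule card_UN_le) simp
        also have "\<dots> \<le> (\<Sum>i<t'. k)" using SJ by (intro sum_mono) (auto intro: less_imp_le)
        also have "\<dots> = t' * k" by simp
        also have "\<dots> \<le> t * k" using Suc.prems by (intro mult_le_mono1) simp
        finally have "real (card U) \<le> real t * real k" by (simp flip: of_nat_mult)
        moreover have "card U \<le> N"
          unfolding N_def using \<open>U \<subseteq> V\<close> V by (rule card_mono[rotated])
        ultimately have "real N \<le> 2 * real (card W)"
          using N unfolding cardW by (simp add: of_nat_diff)
        then obtain j\<^sub>0 T where T: "j\<^sub>0 \<in> {1..q}" "T \<subseteq> W" "\<gamma>' * real k ^ r \<le> cdisc \<rho> c r j\<^sub>0 T"
          using half[OF W] by blast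
        have finW: "finite W" using W V by (rule finite_subset)
        obtain j S' where j: "j \<in> {1..q}" and S': "S' \<subseteq> W"
          and max: "\<And>j' S''. j' \<in> {1..q} \<Longrightarrow> S'' \<subseteq> W \<Longrightarrow> cdisc \<rho> c r j' S'' \<le> cdisc \<rho> c r j S'"
          using exists_maximal_cdisc[OF finW q, of \<rho> c r "\<lambda>_. 0"] by auto
        have "card S' < k"
        proof (rule ccontr)
          assume "\<not> ?thesis"
          then have "k \<le> card S'" by simp
          then have "S' \<noteq> {}" using elim(2) by auto
          have "\<rho> j * real ((card S' - 1) choose (r - 1))
              + ((\<lambda>_. 0) (card S') - (\<lambda>_. 0) (card S' - 1))
            \<le> real (min_degree (colour_induced (complete_hypergraph r V) c j S'))"
            using V S' W \<open>S' \<noteq> {}\<close> r j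
            by (intro min_degree_ge_if_maximal) (auto intro!: max)
          then show False using none[OF j _ \<open>k \<le> card S'\<close>] S' W by auto
        qed
        moreover have "\<gamma>' * real k ^ r \<le> cdisc \<rho> c r j S'"
          using T max[OF T(1,2)] by linarith
        ultimately have "\<forall>i<Suc t'. (S(t' := S')) i \<subseteq> V \<and> card ((S(t' := S')) i) < k \<and>
            (J(t' := j)) i \<in> {1..q} \<and> \<gamma>' * real k ^ r \<le> cdisc \<rho> c r ((J(t' := j)) i) ((S(t' := S')) i)"
          using SJ S' W j by (auto simp: less_Suc_eq)
        moreover have "S i \<inter> S' = {}" if "i < t'" for i
          using S' that by (auto simp: W_def U_def)
        then have "disjoint_family_on (S(t' := S')) {..<Suc t'}"
          using disj by (intro disjoint_family_on_fun_upd) auto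
        ultimately show ?case by (intro exI[of _ "S(t' := S')"] exI[of _ "J(t' := j)"] conjI)
      qed
      from this[of t] obtain S J where disj: "disjoint_family_on S {..<t}"
        and SJ: "\<And>i. i < t \<Longrightarrow> S i \<subseteq> V" "\<And>i. i < t \<Longrightarrow> J i \<in> {1..q}"
          "\<And>i. i < t \<Longrightarrow> \<gamma>' * real k ^ r \<le> cdisc \<rho> c r (J i) (S i)"
        by auto

      have colour: "(\<Sum>i\<in>{i\<in>{..<t}. J i = j}. cdisc \<rho> c r j (S i)) \<le> C * (real q * real k ^ r)"
        if j: "j \<in> {1..q}" for j
      proof -
        let ?I = "{i\<in>{..<t}. J i = j}"
        have "\<bar>\<Sum>i\<in>?I. cdisc \<rho> c r j (S i)\<bar> \<le> C * (real q * real k ^ r)"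
        proof (intro sum_disc[rule_format] conjI)
          show "finite ?I" by simp
          show "\<forall>i\<in>?I. finite (S i)" using SJ(1) V by (auto intro: finite_subset)
          show "disjoint_family_on S ?I"
            using disj by (rule disjoint_family_on_mono[rotated]) auto
          show "\<forall>J'\<subseteq>?I. \<bar>cdisc \<rho> c r j (\<Union>i\<in>J'. S i)\<bar> \<le> real q * real k ^ r"
          proof (intro allI impI small[OF j])
            fix J' assume "J' \<subseteq> ?I"
            then show "(\<Union>i\<in>J'. S i) \<subseteq> V" using SJ(1) by blast
          qed
        qed
        then show ?thesis by simp
      qed
      have "real t * (\<gamma>' * real k ^ r) = (\<Sum>i<t. \<gamma>' * real k ^ r)" by simp
      also have "\<dots> \<le> (\<Sum>i<t. cdisc \<rho> c r (J i) (S i))" using SJ(3) by (intro sum_mono) auto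
      also have "\<dots> = (\<Sum>j=1..q. \<Sum>i\<in>{i\<in>{..<t}. J i = j}. cdisc \<rho> c r (J i) (S i))"
        using SJ(2) by (intro sum.group[symmetric]) auto
      also have "\<dots> = (\<Sum>j=1..q. \<Sum>i\<in>{i\<in>{..<t}. J i = j}. cdisc \<rho> c r j (S i))"
        by (intro sum.cong) auto
      also have "\<dots> \<le> (\<Sum>j=1..q. C * (real q * real k ^ r))" by (intro sum_mono colour)
      also have "\<dots> = real q * (C * real q) * real k ^ r" by simp
      finally have "real t * \<gamma>' * real k ^ r \<le> real q * (C * real q) * real k ^ r"
        by (simp only: mult.assoc)
      then have "real t * \<gamma>' \<le> real q * (C * real q)"
        using k by (simp only: mult_le_cancel_right_pos zero_less_power order_less_le_trans[OF zero_less_one])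
      then show False using t \<gamma>' by (simp add: field_simps)
    qed
  qed
qed

section \<open>A colouring without dense monochromatic subsets\<close>

lemma exists_colour_pmf:
  fixes q :: nat and \<rho> :: "nat \<Rightarrow> real"
  assumes "\<And>i. i \<in> {1..q} \<Longrightarrow> 0 \<le> \<rho> i" "(\<Sum>i=1..q. \<rho> i) = 1"
  shows "\<exists>D. set_pmf D \<subseteq> {1..q} \<and> (\<forall>i\<in>{1..q}. pmf D i = \<rho> i)"
proof -
  define g where "g i = (if i \<in> {1..q} then \<rho> i else 0)" for i
  have g: "0 \<le> g i" for i using assms(1) by (simp add: g_def)
  have "(\<integral>\<^sup>+ i. ennreal (g i) \<partial>count_space UNIV) = (\<Sum>i=1..q. ennreal (g i))"
    by (rule nn_integral_count_space') (auto simp: g_def)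
  also have "\<dots> = ennreal (\<Sum>i=1..q. g i)" using g by (intro sum_ennreal) auto
  also have "(\<Sum>i=1..q. g i) = 1" using assms(2) by (simp add: g_def)
  finally have pmf: "pmf (embed_pmf g) i = g i" for i
    using g by (intro pmf_embed_pmf) auto
  then have "set_pmf (embed_pmf g) \<subseteq> {1..q}"
    by (auto simp: set_pmf_iff g_def split: if_splits)
  then show ?thesis using pmf by (intro exI[of _ "embed_pmf g"]) (auto simp: g_def)
qed

text \<open>The number of edges of colour \<open>j\<close> in a random colouring is binomially distributed.\<close>

lemma prob_colour_class_ge:
  fixes D :: "nat pmf"
  assumes "finite E" "A \<subseteq> E" "A \<noteq> {}" "1 \<le> j" "0 \<le> t"
  shows "measure_pmf.prob (Pi_pmf E 0 (\<lambda>_. D))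
      {f. real (card A) * pmf D j + t \<le> real (card {e\<in>A. f e = j})}
    \<le> exp (- 2 * t\<^sup>2 / real (card A))"
proof -
  have finA: "finite A" using assms(1,2) finite_subset by blast
  have p: "pmf D j \<in> {0..1}" by (simp add: pmf_le_1)
  have bern: "map_pmf (\<lambda>i. i = j) D = bernoulli_pmf (pmf D j)"
  proof (rule pmf_eqI)
    have T: "pmf (map_pmf (\<lambda>i. i = j) D) True = pmf D j"
      by (simp add: pmf_map vimage_def measure_pmf_single)
    show "pmf (map_pmf (\<lambda>i. i = j) D) b = pmf (bernoulli_pmf (pmf D j)) b" for b
      using T p by (cases b) (simp_all add: pmf_False_conv_True)
  qed
  have "binomial_pmf (card A) (pmf D j)
      = map_pmf (\<lambda>f. card {e\<in>A. f e}) (Pi_pmf A (0 = j) (\<lambda>_. map_pmf (\<lambda>i. i = j) D))"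
    unfolding bern by (rule binomial_pmf_altdef'[OF finA refl p])
  also have "\<dots> = map_pmf (\<lambda>f. card {e\<in>A. f e = j}) (Pi_pmf A 0 (\<lambda>_. D))"
    by (subst Pi_pmf_map[OF finA, where dflt = 0]) (simp_all add: pmf.map_comp o_def)
  also have "\<dots> = map_pmf (\<lambda>f. card {e\<in>A. f e = j}) (Pi_pmf E 0 (\<lambda>_. D))"
    by (subst Pi_pmf_subset[OF assms(1,2)])
       (auto simp: pmf.map_comp o_def intro!: map_pmf_cong arg_cong[of _ _ card])
  finally have "measure_pmf.prob (binomial_pmf (card A) (pmf D j)) {x. real (card A) * pmf D j + t \<le> real x}
    = measure_pmf.prob (Pi_pmf E 0 (\<lambda>_. D)) {f. real (card A) * pmf D j + t \<le> real (card {e\<in>A. f e = j})}"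
    by (simp add: vimage_def)
  moreover have "binomial_distribution (pmf D j)" using p by unfold_locales
  then have "measure_pmf.prob (binomial_pmf (card A) (pmf D j)) {x. real (card A) * pmf D j + t \<le> real x}
    \<le> exp (- 2 * t\<^sup>2 / real (card A))"
    using assms finA by (intro binomial_distribution.prob_ge) (auto simp: card_gt_0_iff)
  ultimately show ?thesis by simp
qed

text \<open>The hypothesis \<open>union\<close> bounds the expected number of pairs of a set with at least \<open>k\<close> vertices and
  a colour that is too frequent inside it. So some colouring has no such pair.\<close>

lemma exists_balanced_colouring:
  fixes V :: "'a set" and q r k :: nat and \<rho> :: "nat \<Rightarrow> real" and t :: "nat \<Rightarrow> real"
  assumes V: "finite V" and \<rho>: "\<And>i. i \<in> {1..q} \<Longrightarrow> 0 \<le> \<rho> i" "(\<Sum>i=1..q. \<rho> i) = 1"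
    and "r \<le> k" and t: "\<And>l. 0 \<le> t l"
    and union: "(\<Sum>l=k..card V. real (card V choose l) * (real q * exp (- 2 * (t l)\<^sup>2 / real (l choose r)))) < 1"
  shows "\<exists>c. (\<forall>e\<in>nsets V r. c e \<in> {1..q}) \<and> (\<forall>j\<in>{1..q}. \<forall>S\<subseteq>V. k \<le> card S \<longrightarrow>
    real (card {e\<in>nsets S r. c e = j}) < real (card S choose r) * \<rho> j + t (card S))"
proof -
  obtain D where D: "set_pmf D \<subseteq> {1..q}" "\<And>i. i \<in> {1..q} \<Longrightarrow> pmf D i = \<rho> i"
    using exists_colour_pmf[of q \<rho>, OF \<rho>] by blast
  define M where "M = Pi_pmf (nsets V r) 0 (\<lambda>_. D)"
  define \<phi> where "\<phi> l = exp (- 2 * (t l)\<^sup>2 / real (l choose r))" for l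
  define large where "large = {S\<in>Pow V. k \<le> card S}"
  define bad where "bad = (\<lambda>(S :: 'a set, j). {f. real (card S choose r) * \<rho> j + t (card S)
    \<le> real (card {e\<in>nsets S r. f e = j})})"
  have fin: "finite (nsets V r)" "finite large"
    using V by (auto simp: finite_imp_finite_nsets large_def)
  have "measure_pmf.prob M (\<Union>z\<in>large \<times> {1..q}. bad z) \<le> (\<Sum>z\<in>large \<times> {1..q}. measure_pmf.prob M (bad z))"
    using fin by (intro measure_pmf.finite_measure_subadditive_finite) auto
  also have "\<dots> \<le> (\<Sum>(S, j)\<in>large \<times> {1..q}. \<phi> (card S))"
  proof (rule sum_mono, clarify)
    fix S j assume S: "S \<in> large" and j: "j \<in> {1..q}"
    have finS: "finite S" using S V by (auto simp: large_def intro: finite_subset)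
    have "card (nsets S r) = card S choose r" using finS by (rule card_nsets)
    moreover have "nsets S r \<noteq> {}"
      using S assms(4) finS by (auto simp: nsets_eq_empty_iff large_def)
    moreover have "nsets S r \<subseteq> nsets V r" using S by (intro nsets_mono) (auto simp: large_def)
    ultimately show "measure_pmf.prob M (bad (S, j)) \<le> \<phi> (card S)"
      using prob_colour_class_ge[OF fin(1), of "nsets S r" j "t (card S)" D] j t
      by (simp add: M_def bad_def \<phi>_def D(2))
  qed
  also have "\<dots> = (\<Sum>S\<in>large. real q * \<phi> (card S))"
    by (simp add: sum.cartesian_product[symmetric])
  also have "\<dots> = (\<Sum>l=k..card V. \<Sum>S\<in>{S\<in>large. card S = l}. real q * \<phi> (card S))"
    using fin V by (intro sum.group[symmetric]) (auto simp: large_def intro: card_mono)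
  also have "\<dots> = (\<Sum>l=k..card V. real (card V choose l) * (real q * \<phi> l))"
  proof (rule sum.cong[OF refl])
    fix l assume "l \<in> {k..card V}"
    then have "{S\<in>large. card S = l} = {S. S \<subseteq> V \<and> card S = l}" by (auto simp: large_def)
    then have "card {S\<in>large. card S = l} = card V choose l" using V by (simp add: n_subsets)
    then show "(\<Sum>S\<in>{S\<in>large. card S = l}. real q * \<phi> (card S)) = real (card V choose l) * (real q * \<phi> l)"
      by simp
  qed
  also have "\<dots> < 1" using union by (simp add: \<phi>_def)
  finally have less1: "measure_pmf.prob M (\<Union>z\<in>large \<times> {1..q}. bad z) < 1" .
  have "\<exists>c\<in>set_pmf M. c \<notin> (\<Union>z\<in>large \<times> {1..q}. bad z)"
  proof (rule ccontr)
    assume "\<not> ?thesis"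
    then have "measure_pmf.prob M (\<Union>z\<in>large \<times> {1..q}. bad z) = 1"
      by (subst measure_pmf.prob_eq_1) (auto simp: AE_measure_pmf_iff)
    then show False using less1 by simp
  qed
  then obtain c where c: "c \<in> set_pmf M" "c \<notin> (\<Union>z\<in>large \<times> {1..q}. bad z)" by blast
  have "c e \<in> {1..q}" if "e \<in> nsets V r" for e
    using c(1) that D(1) unfolding M_def set_Pi_pmf[OF fin(1)] PiE_dflt_def by auto
  moreover have "real (card {e\<in>nsets S r. c e = j}) < real (card S choose r) * \<rho> j + t (card S)"
    if "j \<in> {1..q}" "S \<subseteq> V" "k \<le> card S" for j S
    using c(2) that by (auto simp: bad_def large_def not_le)
  ultimately show ?thesis by blast
qed

text \<open>This is \<open>n\<^sup>l / l!\<close> combined with \<open>l\<^sup>l / l! \<le> e\<^sup>l\<close>, where the left-hand side is one term of the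
  exponential series.\<close>

lemma binomial_le_exp_power:
  assumes "1 \<le> l"
  shows "real (n choose l) \<le> (exp 1 * real n / real l) ^ l"
proof -
  have "(\<Sum>i\<in>{l}. real l ^ i /\<^sub>R fact i) \<le> exp (real l)"
    unfolding exp_def by (intro sum_le_suminf summable_exp_generic) auto
  then have "real l ^ l / fact l \<le> exp 1 ^ l"
    using exp_of_nat_mult[of l "1 :: real"] by (simp add: divide_inverse_commute)
  then have fact: "real l ^ l \<le> exp 1 ^ l * fact l" by (simp add: field_simps)
  have "real ((n choose l) * fact l) \<le> real (n ^ l)"
    unfolding of_nat_le_iff by (rule binomial_fact_pow)
  then have "real (n choose l) * fact l * real l ^ l \<le> real n ^ l * (exp 1 ^ l * fact l)"
    using fact by (intro mult_mono) auto
  then have "real (n choose l) * real l ^ l \<le> real n ^ l * exp 1 ^ l"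
    by (simp add: mult_ac)
  then show ?thesis using assms by (simp add: power_divide power_mult_distrib field_simps)
qed

lemma sum_half_powers_le: "(\<Sum>l=k..n. (1 / 2 :: real) ^ l) \<le> 2 * (1 / 2) ^ k"
proof (cases "k \<le> n")
  case True
  then have "(\<Sum>l=k..n. (1 / 2 :: real) ^ l) = 2 * (1 / 2) ^ k - (1 / 2) ^ n"
    by (induction n rule: dec_induct) auto
  then show ?thesis by simp
qed simp

lemma avg_degree_colour_induced:
  assumes "finite V" "S \<subseteq> V"
  shows "avg_degree (colour_induced (complete_hypergraph r V) c j S)
    = real r * real (card {e\<in>nsets S r. c e = j}) / real (card S)"
proof -
  let ?H = "colour_induced (complete_hypergraph r V) c j S" and ?E = "{e\<in>nsets S r. c e = j}"
  have fin: "finite S" using assms(2,1) by (rule finite_subset)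
  have E: "snd ?H = ?E" "fst ?H = S"
    using assms by (auto simp: colour_induced_def complete_hypergraph_def nsets_def)
  have "(\<Sum>v\<in>S. card {e\<in>?E. v \<in> e}) = (\<Sum>e\<in>?E. r)"
  proof (rule sum_multicount_gen)
    show "\<forall>e\<in>?E. card {v\<in>S. v \<in> e} = r"
    proof
      fix e assume "e \<in> ?E"
      then have "{v\<in>S. v \<in> e} = e" "card e = r" by (auto simp: nsets_def)
      then show "card {v\<in>S. v \<in> e} = r" by simp
    qed
  qed (use fin in \<open>auto simp: finite_imp_finite_nsets\<close>)
  then have "(\<Sum>v\<in>S. card {e\<in>?E. v \<in> e}) = r * card ?E" by simp
  then have "(\<Sum>v\<in>S. real (card {e\<in>?E. v \<in> e})) = real r * real (card ?E)"
    by (simp only: of_nat_sum[symmetric] of_nat_mult[symmetric])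
  then show ?thesis by (simp add: avg_degree_def Defs.degree_def E)
qed

text \<open>Colour the edges independently with probabilities \<open>\<rho>\<close>. By Hoeffding's inequality a fixed set of
  \<open>l\<close> vertices is too dense in a fixed colour with probability at most
  \<open>exp (- 2 \<nu>(l)\<^sup>2 l ln l)\<close>, which is at most \<open>l\<^bsup>-al\<^esup>\<close> for \<open>a = \<nu>(k)\<^sup>2\<close>. There are at most
  \<open>(e n / l)\<^sup>l\<close> sets of this size, where \<open>n\<close> is the number of vertices. As \<open>n \<le> k\<^bsup>a+1\<^esup> / 6\<close> and
  \<open>k \<le> l\<close>, the expected number of dense sets of size \<open>l\<close> in a fixed colour is at most
  \<open>(e / 6)\<^sup>l \<le> 2\<^sup>-\<^sup>l\<close>, and these bounds sum to less than \<open>1\<close> over all \<open>l \<ge> k\<close> and all colours.\<close>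

lemma exists_colouring_small_avg_degree:
  fixes r q :: nat and \<rho> :: "nat \<Rightarrow> real" and \<nu> :: "nat \<Rightarrow> real"
  assumes r: "1 \<le> r" and \<rho>: "\<And>i. i \<in> {1..q} \<Longrightarrow> 0 \<le> \<rho> i" "(\<Sum>i=1..q. \<rho> i) = 1"
    and mono: "mono_on {1..} \<nu>" and nonneg: "\<And>m. 1 \<le> m \<Longrightarrow> 0 \<le> \<nu> m"
    and k: "r \<le> k" "2 * q \<le> k" "1 \<le> k"
    and V: "finite V" "real (card V) \<le> 1 / 6 * real k powr ((\<nu> k)\<^sup>2 + 1)"
  shows "\<exists>c. (\<forall>e\<in>nsets V r. c e \<in> {1..q}) \<and> (\<forall>j\<in>{1..q}. \<forall>S\<subseteq>V. k \<le> card S \<longrightarrow>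
    avg_degree (colour_induced (complete_hypergraph r V) c j S)
      < \<rho> j * real ((card S - 1) choose (r - 1))
        + \<nu> (card S) * sqrt (real r * real ((card S - 1) choose (r - 1)) * ln (real (card S))))"
proof -
  define n where "n = card V"
  (* the deviation of the number of edges that corresponds to the allowed surplus of average degree *)
  define t where "t l = (if 1 \<le> l then \<nu> l * sqrt (real (l choose r) * (real l * ln (real l))) else 0)" for l
  have t: "0 \<le> t l" for l using nonneg by (auto simp: t_def)
  have level: "real (n choose l) * (real q * exp (- 2 * (t l)\<^sup>2 / real (l choose r))) \<le> real q * (1 / 2) ^ l"
    if l: "k \<le> l" for l
  proof -
    define a where "a = (\<nu> k)\<^sup>2"
    have l1: "1 \<le> l" using l k by simp
    have "\<nu> k \<le> \<nu> l" using mono l k by (auto simp: mono_on_def)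
    then have a: "a \<le> (\<nu> l)\<^sup>2" unfolding a_def using nonneg k by (intro power_mono) auto
    have N: "0 < real (l choose r)" using k l by simp
    have lnl: "0 \<le> ln (real l)" using l1 by simp
    have "(t l)\<^sup>2 = (\<nu> l)\<^sup>2 * (real (l choose r) * (real l * ln (real l)))"
      using l1 lnl by (simp add: t_def power_mult_distrib)
    then have "- 2 * (t l)\<^sup>2 / real (l choose r) = - (2 * (\<nu> l)\<^sup>2 * (real l * ln (real l)))"
      using N by simp
    also have "\<dots> \<le> - (a * (real l * ln (real l)))"
    proof -
      have "a * (real l * ln (real l)) \<le> 2 * (\<nu> l)\<^sup>2 * (real l * ln (real l))"
      proof (intro mult_right_mono)
        show "a \<le> 2 * (\<nu> l)\<^sup>2" using a zero_le_power2[of "\<nu> l"] by linarith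
      qed (use lnl in auto)
      then show ?thesis by simp
    qed
    finally have "exp (- 2 * (t l)\<^sup>2 / real (l choose r)) \<le> exp (- (a * (real l * ln (real l))))"
      by simp
    also have "\<dots> = exp (real l * (- a * ln (real l)))" by (simp add: mult_ac)
    also have "\<dots> = (real l powr - a) ^ l"
      using l1 unfolding exp_of_nat_mult by (simp add: powr_def)
    finally have e: "exp (- 2 * (t l)\<^sup>2 / real (l choose r)) \<le> (real l powr - a) ^ l" .
    have "exp 1 * real n / real l * real l powr - a \<le> 1 / 2"
    proof -
      have "exp 1 * real n \<le> 3 * (1 / 6 * real k powr (a + 1))"
        using V(2) exp_le unfolding n_def a_def by (intro mult_mono) auto
      also have "\<dots> \<le> 1 / 2 * real l powr (a + 1)"
        using l k powr_mono2[of "a + 1" "real k" "real l"] by (simp add: a_def)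
      also have "\<dots> = 1 / 2 * (real l * real l powr a)" using l1 by (simp add: powr_add)
      finally show ?thesis using l1 by (simp add: powr_minus field_simps)
    qed
    then have "(exp 1 * real n / real l * real l powr - a) ^ l \<le> (1 / 2) ^ l"
      by (intro power_mono) auto
    moreover have "real (n choose l) * exp (- 2 * (t l)\<^sup>2 / real (l choose r))
        \<le> (exp 1 * real n / real l) ^ l * (real l powr - a) ^ l"
      using e binomial_le_exp_power[OF l1, of n] by (intro mult_mono) auto
    ultimately have "real (n choose l) * exp (- 2 * (t l)\<^sup>2 / real (l choose r)) \<le> (1 / 2) ^ l"
      unfolding power_mult_distrib[symmetric] by linarith
    from mult_left_mono[OF this, of "real q"] show ?thesis by (simp add: mult_ac)
  qed
  have "(\<Sum>l=k..n. real (n choose l) * (real q * exp (- 2 * (t l)\<^sup>2 / real (l choose r))))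
      \<le> (\<Sum>l=k..n. real q * (1 / 2) ^ l)"
    by (intro sum_mono level) auto
  also have "\<dots> = real q * (\<Sum>l=k..n. (1 / 2) ^ l)" by (rule sum_distrib_left[symmetric])
  also have "\<dots> \<le> real q * (2 * (1 / 2) ^ k)"
    by (intro mult_left_mono sum_half_powers_le) auto
  also have "\<dots> < 1"
  proof -
    have "2 * q < 2 ^ k" using k(2) less_exp[of k] by linarith
    then have "real (2 * q) < real (2 ^ k)" by (simp only: of_nat_less_iff)
    then show ?thesis by (simp add: power_divide field_simps)
  qed
  finally obtain c where c: "\<forall>e\<in>nsets V r. c e \<in> {1..q}"
    and bal: "\<And>j S. j \<in> {1..q} \<Longrightarrow> S \<subseteq> V \<Longrightarrow> k \<le> card S \<Longrightarrow>
      real (card {e\<in>nsets S r. c e = j}) < real (card S choose r) * \<rho> j + t (card S)"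
    using exists_balanced_colouring[OF V(1), of q \<rho> r k t, OF \<rho> k(1) t] unfolding n_def by blast
  have "avg_degree (colour_induced (complete_hypergraph r V) c j S)
      < \<rho> j * real ((card S - 1) choose (r - 1))
        + \<nu> (card S) * sqrt (real r * real ((card S - 1) choose (r - 1)) * ln (real (card S)))"
    if j: "j \<in> {1..q}" and S: "S \<subseteq> V" "k \<le> card S" for j S
  proof -
    define l where "l = card S"
    have l: "1 \<le> l" "0 < real l" using S k by (auto simp: l_def)
    define B where "B = real ((l - 1) choose (r - 1))"
    have "r * (l choose r) = l * ((l - 1) choose (r - 1))"
      using r by (intro times_binomial_minus1_eq) auto
    then have "real r * real (l choose r) = real l * B"
      unfolding B_def by (simp only: of_nat_mult[symmetric])
    then have N: "real r * real (l choose r) / real l = B" using l by (simp add: field_simps)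
    have "real r * real (card {e\<in>nsets S r. c e = j}) / real l
        < real r * (real (l choose r) * \<rho> j + t l) / real l"
      using bal[OF j S] r l unfolding l_def[symmetric]
      by (intro divide_strict_right_mono mult_strict_left_mono) auto
    also have "\<dots> = \<rho> j * B + \<nu> l * (real r / real l * sqrt (real (l choose r) * (real l * ln (real l))))"
      unfolding N[symmetric] using l by (simp add: t_def field_simps)
    also have "real r / real l * sqrt (real (l choose r) * (real l * ln (real l))) = sqrt (real r * B * ln (real l))"
    proof -
      have "real r / real l = sqrt ((real r / real l)\<^sup>2)" using l by simp
      then have "real r / real l * sqrt (real (l choose r) * (real l * ln (real l)))
          = sqrt ((real r / real l)\<^sup>2 * (real (l choose r) * (real l * ln (real l))))"
        by (simp only: real_sqrt_mult)
      also have "(real r / real l)\<^sup>2 * (real (l choose r) * (real l * ln (real l))) = real r * B * ln (real l)"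
        unfolding N[symmetric] using l by (simp add: power2_eq_square field_simps)
      finally show ?thesis .
    qed
    finally show ?thesis
      unfolding avg_degree_colour_induced[OF V(1) S(1)] l_def B_def .
  qed
  then show ?thesis using c by blast
qed

section \<open>The two bounds\<close>

lemma is_colouring_complete_iff:
  "is_colouring q (complete_hypergraph r V) c \<longleftrightarrow> (\<forall>e\<in>nsets V r. c e \<in> {1..q})"
  by (auto simp: is_colouring_def complete_hypergraph_def)

lemma eventually_dense_subset:
  fixes r q :: nat and \<rho> :: "nat \<Rightarrow> real" and \<nu> :: real
  assumes r: "2 \<le> r" and q: "1 \<le> q" and \<rho>: "\<And>i. i \<in> {1..q} \<Longrightarrow> 0 < \<rho> i \<and> \<rho> i < 1"
    and sum: "(\<Sum>i=1..q. \<rho> i) = 1" and \<nu>: "0 \<le> \<nu>"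
  shows "\<exists>C>0. \<forall>\<epsilon>>0. \<forall>\<^sub>F k in sequentially. \<forall>(V :: 'a set) c.
    finite V \<and> real (card V) \<ge> real k powr (\<nu>^2 * C^2 * (1 + \<epsilon>) + 2 * real r / (real r + 1)) \<and>
    (\<forall>e\<in>nsets V r. c e \<in> {1..q}) \<longrightarrow>
    (\<exists>j\<in>{1..q}. \<exists>S\<subseteq>V. k \<le> card S \<and>
      \<rho> j * real ((card S - 1) choose (r - 1)) + \<nu> * sqrt (real (card S) ^ (r - 1) * ln (real (card S)))
      \<le> real (min_degree (colour_induced (complete_hypergraph r V) c j S)))"
proof (cases "\<nu> = 0")
  case True
  have "\<forall>\<^sub>F k in sequentially. \<forall>(V :: 'a set) c.
    finite V \<and> (\<forall>e\<in>nsets V r. c e \<in> {1..q}) \<and>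
    real k powr (2 * real r / (real r + 1)) \<le> real (card V) \<longrightarrow>
    (\<exists>j\<in>{1..q}. \<exists>S\<subseteq>V. k \<le> card S \<and> \<rho> j * real ((card S - 1) choose (r - 1))
      \<le> real (min_degree (colour_induced (complete_hypergraph r V) c j S)))"
    by (rule min_degree_without_surplus[OF r q \<rho> sum])
  then show ?thesis
    unfolding True by (intro exI[of _ "1 :: real"] conjI allI impI) (auto elim!: eventually_mono)
next
  case False
  then have pos: "0 < \<nu>" using \<nu> by simp
  let ?dense = "\<lambda>k (V :: 'a set) c. \<exists>j\<in>{1..q}. \<exists>S\<subseteq>V. k \<le> card S \<and>
      \<rho> j * real ((card S - 1) choose (r - 1)) + \<nu> * sqrt (real (card S) ^ (r - 1) * ln (real (card S)))
      \<le> real (min_degree (colour_induced (complete_hypergraph r V) c j S))"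
  have "\<exists>K>0. \<forall>\<^sub>F k in sequentially. \<forall>V c. finite V \<and> (\<forall>e\<in>nsets V r. c e \<in> {1..q}) \<and>
      real k powr K \<le> real (card V) \<longrightarrow> ?dense k V c"
    by (rule min_degree_with_surplus[OF r q \<rho> sum pos])
  then obtain K where K: "0 < K" and ev: "\<forall>\<^sub>F k in sequentially. \<forall>V c. finite V \<and>
      (\<forall>e\<in>nsets V r. c e \<in> {1..q}) \<and> real k powr K \<le> real (card V) \<longrightarrow> ?dense k V c"
    by (elim exE conjE)
  (* chosen such that \<nu>^2 * C^2 is the exponent K *)
  define C where "C = sqrt K / \<nu>"
  have C: "0 < C" "\<nu>\<^sup>2 * C\<^sup>2 = K" using K False \<nu> by (auto simp: C_def power_divide)
  show ?thesis
  proof (intro exI[of _ C] conjI allI impI)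
    fix \<epsilon> :: real assume "0 < \<epsilon>"
    have exponent: "K \<le> \<nu>^2 * C^2 * (1 + \<epsilon>) + 2 * real r / (real r + 1)"
    proof -
      have "K * 1 \<le> K * (1 + \<epsilon>)" using K \<open>0 < \<epsilon>\<close> by (intro mult_left_mono) auto
      moreover have "0 \<le> 2 * real r / (real r + 1)" by simp
      ultimately show ?thesis unfolding C(2) by linarith
    qed
    show "\<forall>\<^sub>F k in sequentially. \<forall>V c.
      finite V \<and> real (card V) \<ge> real k powr (\<nu>^2 * C^2 * (1 + \<epsilon>) + 2 * real r / (real r + 1)) \<and>
      (\<forall>e\<in>nsets V r. c e \<in> {1..q}) \<longrightarrow> ?dense k V c"
      using ev eventually_ge_at_top[of 1]
    proof eventually_elim
      case (elim k)
      have exponent_k: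
        "real k powr K \<le> real k powr (\<nu>^2 * C^2 * (1 + \<epsilon>) + 2 * real r / (real r + 1))"
        using elim(2) exponent by (intro powr_mono) auto
      show ?case
      proof (intro allI impI, elim conjE)
        fix V :: "'a set" and c
        assume V: "finite V" "\<forall>e\<in>nsets V r. c e \<in> {1..q}"
          and "real (card V) \<ge> real k powr (\<nu>^2 * C^2 * (1 + \<epsilon>) + 2 * real r / (real r + 1))"
        then have "real k powr K \<le> real (card V)" using exponent_k by linarith
        with V have "finite V \<and> (\<forall>e\<in>nsets V r. c e \<in> {1..q}) \<and> real k powr K \<le> real (card V)"
          by (intro conjI)
        then show "?dense k V c" by (rule elim(1)[THEN spec, THEN spec, THEN mp])
      qed
    qed
  qed (rule C(1))
qed

theorem theorem2:
  fixes r q :: nat and \<rho> :: "nat \<Rightarrow> real"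
  assumes "r \<ge> 2" and "q \<ge> 2"
    and "\<forall>i\<in>{1..q}. 0 < \<rho> i \<and> \<rho> i < 1"
    and "(\<Sum>i=1..q. \<rho> i) = 1"
  shows
    "(\<forall>\<nu>::real. \<nu> \<ge> 0 \<longrightarrow>
       (\<exists>C::real. C > 0 \<and>
         (\<forall>\<epsilon>::real. \<epsilon> > 0 \<longrightarrow>
           (\<forall>\<^sub>F k::nat in sequentially.
             \<forall>(V::nat set) c.
               finite V \<and>
               real (card V) \<ge>
                 real k powr (\<nu>^2 * C^2 * (1 + \<epsilon>) + 2 * real r / (real r + 1)) \<and>
               is_colouring q (complete_hypergraph r V) c \<longrightarrow>
               (\<exists>j\<in>{1..q}. \<exists>S l. S \<subseteq> V \<and> card S = l \<and> l \<ge> k \<and>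
                  real (min_degree (colour_induced (complete_hypergraph r V) c j S))
                    \<ge> \<rho> j * real ((l - 1) choose (r - 1))
                       + \<nu> * sqrt (real l ^ (r - 1) * ln (real l)))))))
     \<and>
     (\<exists>C::real. C > 0 \<and>
       (\<forall>\<nu>::nat \<Rightarrow> real. mono_on {1..} \<nu> \<and> (\<forall>m\<ge>1. \<nu> m \<ge> 0) \<longrightarrow>
         (\<forall>\<^sub>F k::nat in sequentially.
           \<forall>V::nat set.
             finite V \<and> int (card V) = \<lfloor>C * real k powr ((\<nu> k)^2 + 1)\<rfloor> \<longrightarrow>
             (\<exists>c. is_colouring q (complete_hypergraph r V) c \<and>
               (\<forall>j\<in>{1..q}. \<forall>S l. S \<subseteq> V \<and> card S = l \<and> l \<ge> k \<longrightarrow>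
                  avg_degree (colour_induced (complete_hypergraph r V) c j S)
                    < \<rho> j * real ((l - 1) choose (r - 1))
                       + \<nu> l * sqrt (real r * real ((l - 1) choose (r - 1)) * ln (real l)))))))"
proof -
  have r: "2 \<le> r" "1 \<le> r" and q: "1 \<le> q" using assms(1,2) by auto
  have \<rho>: "\<And>i. i \<in> {1..q} \<Longrightarrow> 0 < \<rho> i \<and> \<rho> i < 1" "\<And>i. i \<in> {1..q} \<Longrightarrow> 0 \<le> \<rho> i"
    using assms(3) by (auto intro: less_imp_le)
  show ?thesis
  proof (intro conjI allI impI, goal_cases)
    case (1 \<nu>)
    let ?dense = "\<lambda>k (V :: nat set) c. \<exists>j\<in>{1..q}. \<exists>S\<subseteq>V. k \<le> card S \<and>
      \<rho> j * real ((card S - 1) choose (r - 1)) + \<nu> * sqrt (real (card S) ^ (r - 1) * ln (real (card S)))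
      \<le> real (min_degree (colour_induced (complete_hypergraph r V) c j S))"
    have "\<exists>C>0. \<forall>\<epsilon>>0. \<forall>\<^sub>F k in sequentially. \<forall>V c.
      finite V \<and> real (card V) \<ge> real k powr (\<nu>^2 * C^2 * (1 + \<epsilon>) + 2 * real r / (real r + 1)) \<and>
      (\<forall>e\<in>nsets V r. c e \<in> {1..q}) \<longrightarrow> ?dense k V c"
      by (rule eventually_dense_subset[OF r(1) q \<rho>(1) assms(4) 1])
    then obtain C where C: "0 < C" and ev: "\<forall>\<epsilon>>0. \<forall>\<^sub>F k in sequentially. \<forall>V c.
      finite V \<and> real (card V) \<ge> real k powr (\<nu>^2 * C^2 * (1 + \<epsilon>) + 2 * real r / (real r + 1)) \<and>
      (\<forall>e\<in>nsets V r. c e \<in> {1..q}) \<longrightarrow> ?dense k V c"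
      by (elim exE conjE)
    show ?case
    proof (intro exI[of _ C] conjI allI impI C, goal_cases)
      case (1 \<epsilon>)
      from ev[rule_format, OF 1] show ?case
      proof eventually_elim
        case (elim k)
        show ?case
        proof (intro allI impI, goal_cases)
          case (1 V c)
          with elim[rule_format, of V c] obtain j S where "j \<in> {1..q}" "S \<subseteq> V" "k \<le> card S"
            "\<rho> j * real ((card S - 1) choose (r - 1))
              + \<nu> * sqrt (real (card S) ^ (r - 1) * ln (real (card S)))
              \<le> real (min_degree (colour_induced (complete_hypergraph r V) c j S))"
            unfolding is_colouring_complete_iff by blast
          then show ?case by (intro bexI[of _ j] exI[of _ S] exI[of _ "card S"]) simp_all
        qed
      qed
    qed
  next
    case 2
    show ?case
    proof (intro exI[of _ "1 / 6 :: real"] conjI allI impI, goal_cases)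
      case 1
      show ?case by simp
    next
      case (2 \<nu>)
      from eventually_ge_at_top[of "r + 2 * q + 1"] show ?case
      proof eventually_elim
        case (elim k)
        show ?case
        proof (intro allI impI, elim conjE)
          fix V :: "nat set"
          assume V: "finite V" "int (card V) = \<lfloor>1 / 6 * real k powr ((\<nu> k)\<^sup>2 + 1)\<rfloor>"
          have "real (card V) \<le> 1 / 6 * real k powr ((\<nu> k)\<^sup>2 + 1)"
            using V(2) by linarith
          then obtain c where "\<forall>e\<in>nsets V r. c e \<in> {1..q}" and
            "\<forall>j\<in>{1..q}. \<forall>S\<subseteq>V. k \<le> card S \<longrightarrow>
              avg_degree (colour_induced (complete_hypergraph r V) c j S)
              < \<rho> j * real ((card S - 1) choose (r - 1))
                + \<nu> (card S) * sqrt (real r * real ((card S - 1) choose (r - 1)) * ln (real (card S)))"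
            using exists_colouring_small_avg_degree[OF r(2) \<rho>(2) assms(4), of \<nu> k V] 2 elim V(1)
            by auto
          then show "\<exists>c. is_colouring q (complete_hypergraph r V) c \<and>
            (\<forall>j\<in>{1..q}. \<forall>S l. S \<subseteq> V \<and> card S = l \<and> l \<ge> k \<longrightarrow>
              avg_degree (colour_induced (complete_hypergraph r V) c j S)
              < \<rho> j * real ((l - 1) choose (r - 1))
                + \<nu> l * sqrt (real r * real ((l - 1) choose (r - 1)) * ln (real l)))"
            unfolding is_colouring_complete_iff by blast
        qed
      qed
    qed
  qed
qed

end
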